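(* Let $n\geq 1$ and let $\sigma\in S_n$ be a permutation. Then the Bruhat graph $\mathcal{B}(\sigma)$ is planar if and only if $\sigma$ avoids the permutation $321$ and $\ell(\sigma)\leq 3$.
   Context: Permutations are written in one-line notation. The length $\ell(\pi)$ of $\pi\in S_n$ is the minimum number of adjacent transpositions $(i\ i+1)$ whose product is $\pi$; equivalently, it is the number of inversions, i.e. pairs $i<j$ with $\pi(i)>\pi(j)$. For $\sigma,\tau\in S_n$ write $\sigma\prec\tau$ if $\ell(\sigma)<\ell(\tau)$ and there is a transposition $t=(i\ j)$ (not necessarily adjacent) with $\sigma=\tau t$. Bruhat order $\leq$ on $S_n$ is the reflexive transitive closure of $\prec$. The Bruhat graph of $S_n$ is the directed graph with vertex set $S_n$ and an edge $\sigma\to\tau$ whenever $\sigma\prec\tau$ (the difference $\ell(\tau)-\ell(\sigma)$ need not be $1$). For $\pi\in S_n$, the Bruhat graph $\mathcal{B}(\pi)$ is the induced subgraph on the vertices $\sigma\in S_n$ with $\sigma\leq\pi$ in Bruhat order. For $\pi\in S_k$ and $\tau\in S_n$ with $k\leq n$, $\tau$ contains $\pi$ if there are indices $1\leq i_1<\cdots<i_k\leq n$ such that for all $a,b$, $\tau(i_a)<\tau(i_b)$ if and only if $\pi(a)<\pi(b)$; otherwise (or if $k>n$) $\tau$ avoids $\pi$. A graph is planar if it can be drawn in the plane without edges crossing; for $\mathcal{B}(\sigma)$ this refers to the underlying undirected graph. *)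

theory Defs
  imports
    "HOL-Analysis.Analysis"
    "HOL-Combinatorics.Permutations"
    "Graph_Theory.Graph_Theory"
begin

text \<open>
  The symmetric group $S_n$ consists of the functions \<^term>\<open>\<pi> :: nat \<Rightarrow> nat\<close> with
  \<^term>\<open>\<pi> permutes {1..n}\<close>; such functions are the identity outside \<^term>\<open>{1..n}\<close>.
  Products are compositions, so $\tau t$ is \<^term>\<open>\<tau> \<circ> t\<close>.
\<close>

definition one_line :: "nat list \<Rightarrow> nat \<Rightarrow> nat" where
  "one_line xs i = (if i \<in> {1..length xs} then xs ! (i - 1) else i)"

text \<open>
  A list of indices encodes the product, in order, of the corresponding adjacent transpositions.
  Every element of $S_n$ is such a product, so the minimum below exists for
  \<^term>\<open>\<pi> permutes {1..n}\<close>; the value is irrelevant otherwise.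
\<close>

definition adjacent_product :: "nat list \<Rightarrow> nat \<Rightarrow> nat" where
  "adjacent_product is = foldr (\<circ>) (map (\<lambda>i. Transposition.transpose i (i + 1)) is) id"

definition perm_length :: "nat \<Rightarrow> (nat \<Rightarrow> nat) \<Rightarrow> nat" where
  "perm_length n \<pi> =
     (LEAST k. \<exists>is. length is = k \<and> set is \<subseteq> {1..<n} \<and> \<pi> = adjacent_product is)"

definition bruhat_step :: "nat \<Rightarrow> (nat \<Rightarrow> nat) \<Rightarrow> (nat \<Rightarrow> nat) \<Rightarrow> bool" where
  "bruhat_step n \<sigma> \<tau> \<longleftrightarrow>
     \<sigma> permutes {1..n} \<and> \<tau> permutes {1..n} \<and>
     perm_length n \<sigma> < perm_length n \<tau> \<and>
     (\<exists>i\<in>{1..n}. \<exists>j\<in>{1..n}. i \<noteq> j \<and> \<sigma> = \<tau> \<circ> Transposition.transpose i j)"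

definition bruhat_le :: "nat \<Rightarrow> (nat \<Rightarrow> nat) \<Rightarrow> (nat \<Rightarrow> nat) \<Rightarrow> bool" where
  "bruhat_le n = (bruhat_step n)\<^sup>*\<^sup>*"

definition full_bruhat_graph :: "nat \<Rightarrow> (nat \<Rightarrow> nat) pair_pre_digraph" where
  "full_bruhat_graph n =
     \<lparr> pverts = {\<sigma>. \<sigma> permutes {1..n}}, parcs = {(\<sigma>, \<tau>). bruhat_step n \<sigma> \<tau>} \<rparr>"

definition bruhat_graph ::
    "nat \<Rightarrow> (nat \<Rightarrow> nat) \<Rightarrow> (nat \<Rightarrow> nat, (nat \<Rightarrow> nat) \<times> (nat \<Rightarrow> nat)) pre_digraph" where
  "bruhat_graph n \<pi> =
     induce_subgraph (with_proj (full_bruhat_graph n)) {\<sigma>. \<sigma> permutes {1..n} \<and> bruhat_le n \<sigma> \<pi>}"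

text \<open>
  Here \<open>\<tau>\<close> is in $S_n$ and \<open>\<pi>\<close> in $S_k$. No suitable index map exists when \<^term>\<open>k > n\<close>, so
  \<open>\<tau>\<close> avoids \<open>\<pi>\<close> in that case.
\<close>

definition contains_pattern :: "nat \<Rightarrow> (nat \<Rightarrow> nat) \<Rightarrow> nat \<Rightarrow> (nat \<Rightarrow> nat) \<Rightarrow> bool" where
  "contains_pattern n \<tau> k \<pi> \<longleftrightarrow>
     (\<exists>idx :: nat \<Rightarrow> nat. strict_mono_on {1..k} idx \<and> idx ` {1..k} \<subseteq> {1..n} \<and>
        (\<forall>a\<in>{1..k}. \<forall>b\<in>{1..k}. \<tau> (idx a) < \<tau> (idx b) \<longleftrightarrow> \<pi> a < \<pi> b))"

definition avoids_pattern :: "nat \<Rightarrow> (nat \<Rightarrow> nat) \<Rightarrow> nat \<Rightarrow> (nat \<Rightarrow> nat) \<Rightarrow> bool" where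
  "avoids_pattern n \<tau> k \<pi> \<longleftrightarrow> \<not> contains_pattern n \<tau> k \<pi>"

definition undirected_edges :: "('a, 'b) pre_digraph \<Rightarrow> 'a set set" where
  "undirected_edges G = (\<lambda>e. {tail G e, head G e}) ` arcs G"

text \<open>
  A drawing of an undirected graph in the plane, identified with \<^typ>\<open>complex\<close>: vertices are
  distinct points, each edge is a continuous non-self-intersecting curve joining its endpoints
  (a simple closed curve for a loop), an edge meets no vertex other than its endpoints, and
  two distinct edges meet only at vertices, hence only at common endpoints.
\<close>

definition plane_drawing ::
    "'a set \<Rightarrow> 'a set set \<Rightarrow> ('a \<Rightarrow> complex) \<Rightarrow> ('a set \<Rightarrow> real \<Rightarrow> complex) \<Rightarrow> bool" where
  "plane_drawing V E pos curve \<longleftrightarrow>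
     inj_on pos V \<and>
     (\<forall>e\<in>E. simple_path (curve e) \<and>
        {pathstart (curve e), pathfinish (curve e)} = pos ` e \<and>
        path_image (curve e) \<inter> pos ` V = pos ` e) \<and>
     (\<forall>e\<in>E. \<forall>f\<in>E. e \<noteq> f \<longrightarrow> path_image (curve e) \<inter> path_image (curve f) \<subseteq> pos ` V)"

definition planar :: "('a, 'b) pre_digraph \<Rightarrow> bool" where
  "planar G \<longleftrightarrow> (\<exists>pos curve. plane_drawing (verts G) (undirected_edges G) pos curve)"

end

theory Submission
  imports Defs
begin

text \<open>
  If some \<open>\<tau> \<le> \<sigma>\<close> contains 321, the six rearrangements of its three entries span a $K_{3,3}$ in the
  Bruhat graph. If $\ell(\sigma) \ge 4$, a suffix of length four of a reduced word of \<open>\<sigma>\<close> gives an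
  element below \<open>\<sigma>\<close>. When a letter of this suffix repeats, reducedness forces an element $s_a s_b s_a$
  with $|a - b| = 1$, which contains 321, to lie below it. When the letters are distinct, subwords
  embed the four-dimensional cube, which contains a subdivision of $K_{3,3}$. Conversely, a
  321-avoiding \<open>\<sigma>\<close> of length at most three has a reduced word with distinct letters; by the strong
  exchange property everything below \<open>\<sigma>\<close> is a subword and edges delete one letter, so the graph
  embeds into the three-dimensional cube.
\<close>

section \<open>Arcs in the plane\<close>

text \<open>Edges are arbitrary continuous curves, so nonplanarity of K_{3,3} is a topological
  statement. It rests on the Jordan curve theorem, by way of the three faces of a theta curve;
  Janiszewski's theorem supplies what a picture takes for granted, that one of the three arcs meets
  the inside of the other two.

  Edges with length difference above 1 are decisive. In S_3 the covering relations alone give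
  K_{3,3} minus one edge, which is planar; the edge between 321 and 123 completes it. Below a word
  with distinct letters no such long edge exists, because reversing an inversion deletes exactly one
  letter and leaves a word that is still reduced. That is why repeated letters and long words are
  the only two obstructions.\<close>

lemma connected_subset_inside:
  assumes "topological_space_class.connected T" "T \<inter> S = {}" "x \<in> T" "x \<in> inside S"
  shows "T \<subseteq> inside S"
proof
  fix y assume "y \<in> T"
  then have "connected_component (- S) x y"
    using assms unfolding connected_component_def by blast
  then show "y \<in> inside S"
    using assms inside_same_component by blast
qed

lemma connected_subset_outside:
  assumes "topological_space_class.connected T" "T \<inter> S = {}" "x \<in> T" "x \<in> outside S"
  shows "T \<subseteq> outside S"
proof
  fix y assume "y \<in> T"
  then have "connected_component (- S) x y"
    using assms unfolding connected_component_def by blast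
  then show "y \<in> outside S"
    using assms outside_same_component by blast
qed

lemma arc_interior_point:
  assumes "arc c" "pathstart c = a" "pathfinish c = b"
  obtains y where "y \<in> path_image c" "y \<notin> {a, b}"
proof -
  have "path_image c - {a, b} \<noteq> {}"
    using assms simple_path_endless[of c] arc_imp_simple_path[of c] by auto
  then show thesis using that by blast
qed

section \<open>Theta curves and their faces\<close>

text \<open>Jordan curve theorem for the closed curve that runs along \<open>c1\<close> and back
  along \<open>c2\<close>.\<close>

lemma two_arcs_inside_outside:
  fixes c1 c2 :: "real \<Rightarrow> complex"
  assumes "arc c1" "pathstart c1 = a" "pathfinish c1 = b"
    and "arc c2" "pathstart c2 = a" "pathfinish c2 = b"
    and "path_image c1 \<inter> path_image c2 = {a, b}"
  defines "P \<equiv> path_image c1 \<union> path_image c2"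
  shows "inside P \<noteq> {}" "topological_space_class.connected (inside P)" "topological_space_class.connected (outside P)" "frontier (inside P) = P"
proof -
  have 1: "simple_path (c1 +++ reversepath c2)"
    using assms by (simp add: simple_path_join_loop_eq arc_reversepath)
  have 2: "path_image (c1 +++ reversepath c2) = P"
    using assms by (simp add: path_image_join)
  show "inside P \<noteq> {}" "topological_space_class.connected (inside P)" "topological_space_class.connected (outside P)" "frontier (inside P) = P"
    using Jordan_inside_outside[OF 1] assms(2-6) unfolding 2 by auto
qed

text \<open>
  If no arc of a theta curve met the inside of the other two, then the inside of \<open>c2 \<union> c3\<close> would
  lie outside both \<open>c1 \<union> c2\<close> and \<open>c1 \<union> c3\<close>. These closed curves meet in the connected set \<open>c1\<close>, so
  Janiszewski's theorem would connect that inside to infinity off all three arcs.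
\<close>

lemma theta_inside:
  fixes c1 c2 c3 :: "real \<Rightarrow> complex"
  assumes arcs: "arc c1" "arc c2" "arc c3"
    and starts: "pathstart c1 = a" "pathstart c2 = a" "pathstart c3 = a"
    and finishes: "pathfinish c1 = b" "pathfinish c2 = b" "pathfinish c3 = b"
    and int12: "path_image c1 \<inter> path_image c2 = {a, b}"
    and int13: "path_image c1 \<inter> path_image c3 = {a, b}"
    and int23: "path_image c2 \<inter> path_image c3 = {a, b}"
  shows "path_image c3 \<inter> inside (path_image c1 \<union> path_image c2) \<noteq> {} \<or>
         path_image c2 \<inter> inside (path_image c1 \<union> path_image c3) \<noteq> {} \<or>
         path_image c1 \<inter> inside (path_image c2 \<union> path_image c3) \<noteq> {}"
proof (rule ccontr)
  define P1 P2 P3 where P_def: "P1 = path_image c1" "P2 = path_image c2" "P3 = path_image c3"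
  assume "\<not> ?thesis"
  then have n3: "P3 \<inter> inside (P1 \<union> P2) = {}" and n2: "P2 \<inter> inside (P1 \<union> P3) = {}"
    and n1: "P1 \<inter> inside (P2 \<union> P3) = {}"
    by (auto simp: P_def)
  have ints: "P1 \<inter> P2 = {a, b}" "P1 \<inter> P3 = {a, b}" "P2 \<inter> P3 = {a, b}"
    using int12 int13 int23 by (simp_all add: P_def)
  have comp: "compact P1" "compact P2" "compact P3"
    using arcs by (simp_all add: P_def compact_arc_image)
  note J12 = two_arcs_inside_outside[OF arcs(1) starts(1) finishes(1) arcs(2) starts(2) finishes(2) int12,
      folded P_def]
  note J13 = two_arcs_inside_outside[OF arcs(1) starts(1) finishes(1) arcs(3) starts(3) finishes(3) int13,
      folded P_def]
  note J23 = two_arcs_inside_outside[OF arcs(2) starts(2) finishes(2) arcs(3) starts(3) finishes(3) int23,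
      folded P_def]
  obtain x where x: "x \<in> inside (P2 \<union> P3)" using J23 by blast
  have disj: "inside (P2 \<union> P3) \<inter> (P2 \<union> P3) = {}" by (simp add: inside_no_overlap)
  then have x123: "x \<notin> P1" "x \<notin> P2" "x \<notin> P3" using x n1 by blast+
  have P23: "P2 \<union> P3 \<subseteq> closure (inside (P2 \<union> P3))"
    using J23(4) by (metis frontier_def Diff_subset)
  \<comment> \<open>Otherwise all of \<open>inside (P2 \<union> P3)\<close> lies inside
    \<open>P1 \<union> P2\<close>. Its closure contains \<open>P3\<close>, so interior points of
    \<open>c3\<close> would lie inside \<open>P1 \<union> P2\<close>, against
    \<open>n3\<close>.\<close>
  have "x \<in> outside (P1 \<union> P2)"
  proof (rule ccontr)
    assume "x \<notin> outside (P1 \<union> P2)"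
    then have xi: "x \<in> inside (P1 \<union> P2)"
      using x123 by (auto simp: inside_outside[of "P1 \<union> P2"])
    have "inside (P2 \<union> P3) \<subseteq> inside (P1 \<union> P2)"
      using connected_subset_inside[OF J23(2) _ x xi] n1 disj by blast
    then have "closure (inside (P2 \<union> P3)) \<subseteq> P1 \<union> P2 \<union> inside (P1 \<union> P2)"
      using closure_inside_subset[of "P1 \<union> P2"] closure_mono comp
      by (metis closed_Un compact_imp_closed dual_order.trans)
    moreover obtain y where "y \<in> P3" "y \<notin> {a, b}"
      using arc_interior_point[OF arcs(3) starts(3) finishes(3)] P_def(3) by blast
    moreover from this have "y \<notin> P1" "y \<notin> P2" using ints by blast+
    ultimately show False using P23 n3 by blast
  qed
  moreover have "x \<in> outside (P1 \<union> P3)"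
  proof (rule ccontr)
    assume "x \<notin> outside (P1 \<union> P3)"
    then have xi: "x \<in> inside (P1 \<union> P3)"
      using x123 by (auto simp: inside_outside[of "P1 \<union> P3"])
    have "inside (P2 \<union> P3) \<subseteq> inside (P1 \<union> P3)"
      using connected_subset_inside[OF J23(2) _ x xi] n1 disj by blast
    then have "closure (inside (P2 \<union> P3)) \<subseteq> P1 \<union> P3 \<union> inside (P1 \<union> P3)"
      using closure_inside_subset[of "P1 \<union> P3"] closure_mono comp
      by (metis closed_Un compact_imp_closed dual_order.trans)
    moreover obtain y where "y \<in> P2" "y \<notin> {a, b}"
      using arc_interior_point[OF arcs(2) starts(2) finishes(2)] P_def(2) by blast
    moreover from this have "y \<notin> P1" "y \<notin> P3" using ints by blast+
    ultimately show False using P23 n2 by blast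
  qed
  moreover obtain z where z: "z \<in> outside (P1 \<union> P2 \<union> P3)"
    using outside_bounded_nonempty[of "P1 \<union> P2 \<union> P3"] comp compact_imp_bounded by auto
  moreover from z have "z \<in> outside (P1 \<union> P2)" "z \<in> outside (P1 \<union> P3)" "z \<in> outside (P2 \<union> P3)"
    using outside_mono[of "P1 \<union> P2" "P1 \<union> P2 \<union> P3"] outside_mono[of "P1 \<union> P3" "P1 \<union> P2 \<union> P3"]
      outside_mono[of "P2 \<union> P3" "P1 \<union> P2 \<union> P3"] by auto
  ultimately have "connected_component (- (P1 \<union> P2)) x z"
    using J12(3) outside_no_overlap[of "P1 \<union> P2"] unfolding connected_component_def by blast
  moreover have "connected_component (- (P1 \<union> P3)) x z"
    using J13(3) outside_no_overlap[of "P1 \<union> P3"] \<open>x \<in> outside (P1 \<union> P3)\<close>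
      \<open>z \<in> outside (P1 \<union> P3)\<close> unfolding connected_component_def by blast
  moreover have "(P1 \<union> P2) \<inter> (P1 \<union> P3) = P1"
    using ints by blast
  moreover have "topological_space_class.connected P1" using arcs(1) by (simp add: P_def connected_arc_image)
  ultimately have "connected_component (- (P1 \<union> P2 \<union> (P1 \<union> P3))) x z"
    using comp by (intro Janiszewski[of "P1 \<union> P2" "P1 \<union> P3"]) (simp_all only: compact_Un compact_imp_closed)
  then have "connected_component (- (P2 \<union> P3)) x z"
    by (rule connected_component_of_subset) auto
  then have "z \<in> inside (P2 \<union> P3)" using x inside_same_component by blast
  with \<open>z \<in> outside (P2 \<union> P3)\<close> show False using inside_Int_outside by blast
qed

text \<open>When \<open>c3\<close> runs inside \<open>c1 \<union> c2\<close>, the theta curve has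
  three faces: the outside of \<open>c1 \<union> c2\<close> and the insides of
  \<open>c1 \<union> c3\<close> and \<open>c2 \<union> c3\<close>. The closure of each face misses
  the interior of one arc, so a connected set off the curve cannot accumulate at interior points of
  all three.\<close>

lemma theta_face_aux:
  fixes c1 c2 c3 :: "real \<Rightarrow> complex"
  assumes arcs: "arc c1" "arc c2" "arc c3"
    and starts: "pathstart c1 = a" "pathstart c2 = a" "pathstart c3 = a"
    and finishes: "pathfinish c1 = b" "pathfinish c2 = b" "pathfinish c3 = b"
    and int12: "path_image c1 \<inter> path_image c2 = {a, b}"
    and int13: "path_image c1 \<inter> path_image c3 = {a, b}"
    and int23: "path_image c2 \<inter> path_image c3 = {a, b}"
    and ne: "path_image c3 \<inter> inside (path_image c1 \<union> path_image c2) \<noteq> {}"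
    and X: "topological_space_class.connected X" "X \<inter> (path_image c1 \<union> path_image c2 \<union> path_image c3) = {}"
    and lim: "b1 \<in> closure X" "b2 \<in> closure X" "b3 \<in> closure X"
    and on: "b1 \<in> path_image c1 - {a, b}" "b2 \<in> path_image c2 - {a, b}" "b3 \<in> path_image c3 - {a, b}"
  shows False
proof -
  define P1 P2 P3 where P_def: "P1 = path_image c1" "P2 = path_image c2" "P3 = path_image c3"
  have ints: "P1 \<inter> P2 = {a, b}" "P1 \<inter> P3 = {a, b}" "P2 \<inter> P3 = {a, b}"
    using int12 int13 int23 by (simp_all add: P_def)
  have clo: "closed P1" "closed P2" "closed P3"
    using arcs by (simp_all add: P_def closed_arc_image)
  have sp: "simple_path c1" "simple_path c2" "simple_path c3" and "a \<noteq> b"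
    using arcs starts finishes arc_imp_simple_path arc_distinct_ends by blast+
  then obtain split: "inside (P1 \<union> P3) \<union> inside (P2 \<union> P3) \<union> (P3 - {a, b}) = inside (P1 \<union> P2)"
    using split_inside_simple_closed_curve[OF sp(1) starts(1) finishes(1) sp(2) starts(2) finishes(2)
        sp(3) starts(3) finishes(3) _ int12 int13 int23 ne] unfolding P_def by metis
  obtain x where x: "x \<in> X" using lim(1) by fastforce
  have away: "X \<inter> (P1 \<union> P2) = {}" "X \<inter> (P1 \<union> P3) = {}" "X \<inter> (P2 \<union> P3) = {}"
    using X(2) by (auto simp: P_def)
  have b: "b1 \<in> P1" "b1 \<notin> P2" "b1 \<notin> P3" "b2 \<in> P2" "b2 \<notin> P1" "b2 \<notin> P3"
    "b3 \<in> P3 - {a, b}" "b3 \<notin> P1" "b3 \<notin> P2"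
    using on ints unfolding P_def[symmetric] by blast+
  show False
  proof (cases "x \<in> outside (P1 \<union> P2)")
    case True
    have "X \<subseteq> outside (P1 \<union> P2)" using connected_subset_outside[OF X(1) away(1) x True] .
    then have "closure X \<subseteq> P1 \<union> P2 \<union> outside (P1 \<union> P2)"
      using closure_outside_subset[of "P1 \<union> P2"] closure_mono clo
      by (metis closed_Un dual_order.trans)
    then have "b3 \<in> outside (P1 \<union> P2)" using lim(3) b by blast
    moreover have "b3 \<in> inside (P1 \<union> P2)" using split b by blast
    ultimately show False using inside_Int_outside by blast
  next
    case False
    then have "x \<in> inside (P1 \<union> P2)"
      using x away(1) by (auto simp: inside_outside)
    then consider "x \<in> inside (P1 \<union> P3)" | "x \<in> inside (P2 \<union> P3)"
      using split x away by blast
    then show False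
    proof cases
      case 1
      have "X \<subseteq> inside (P1 \<union> P3)" using connected_subset_inside[OF X(1) away(2) x 1] .
      then have "closure X \<subseteq> P1 \<union> P3 \<union> inside (P1 \<union> P3)"
        using closure_inside_subset[of "P1 \<union> P3"] closure_mono clo
        by (metis closed_Un dual_order.trans)
      then have "b2 \<in> inside (P1 \<union> P2)" using lim(2) b split by blast
      then show False using b inside_no_overlap by blast
    next
      case 2
      have "X \<subseteq> inside (P2 \<union> P3)" using connected_subset_inside[OF X(1) away(3) x 2] .
      then have "closure X \<subseteq> P2 \<union> P3 \<union> inside (P2 \<union> P3)"
        using closure_inside_subset[of "P2 \<union> P3"] closure_mono clo
        by (metis closed_Un dual_order.trans)
      then have "b1 \<in> inside (P1 \<union> P2)" using lim(1) b split by blast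
      then show False using b inside_no_overlap by blast
    qed
  qed
qed

text \<open>The three arcs play symmetric roles, and by \<open>theta_inside\<close> one of them
  meets the inside of the other two; renaming reduces to that case.\<close>

lemma theta_face:
  fixes c1 c2 c3 :: "real \<Rightarrow> complex"
  assumes arcs: "arc c1" "arc c2" "arc c3"
    and starts: "pathstart c1 = a" "pathstart c2 = a" "pathstart c3 = a"
    and finishes: "pathfinish c1 = b" "pathfinish c2 = b" "pathfinish c3 = b"
    and int12: "path_image c1 \<inter> path_image c2 = {a, b}"
    and int13: "path_image c1 \<inter> path_image c3 = {a, b}"
    and int23: "path_image c2 \<inter> path_image c3 = {a, b}"
    and X: "topological_space_class.connected X" "X \<inter> (path_image c1 \<union> path_image c2 \<union> path_image c3) = {}"
    and lim: "b1 \<in> closure X" "b2 \<in> closure X" "b3 \<in> closure X"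
    and on: "b1 \<in> path_image c1 - {a, b}" "b2 \<in> path_image c2 - {a, b}" "b3 \<in> path_image c3 - {a, b}"
  shows False
proof -
  have int21: "path_image c2 \<inter> path_image c1 = {a, b}"
    and int31: "path_image c3 \<inter> path_image c1 = {a, b}"
    and int32: "path_image c3 \<inter> path_image c2 = {a, b}"
    using int12 int13 int23 by (simp_all add: Int_commute)
  consider "path_image c3 \<inter> inside (path_image c1 \<union> path_image c2) \<noteq> {}"
    | "path_image c2 \<inter> inside (path_image c1 \<union> path_image c3) \<noteq> {}"
    | "path_image c1 \<inter> inside (path_image c2 \<union> path_image c3) \<noteq> {}"
    using theta_inside[OF arcs starts finishes int12 int13 int23] by blast
  then show False
  proof cases
    case 1
    show False
      by (rule theta_face_aux[OF arcs starts finishes int12 int13 int23 1 X lim on])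
  next
    case 2
    show False
      by (rule theta_face_aux[OF arcs(1) arcs(3) arcs(2) starts(1) starts(3) starts(2)
            finishes(1) finishes(3) finishes(2) int13 int12 int32 2 X(1) _ lim(1) lim(3) lim(2)
            on(1) on(3) on(2)]) (use X(2) in auto)
  next
    case 3
    show False
      by (rule theta_face_aux[OF arcs(2) arcs(3) arcs(1) starts(2) starts(3) starts(1)
            finishes(2) finishes(3) finishes(1) int23 int21 int31 3 X(1) _ lim(2) lim(3) lim(1)
            on(2) on(3) on(1)]) (use X(2) in auto)
  qed
qed

section \<open>K_{3,3} drawn with arcs\<close>

text \<open>The arc without its end is the continuous image of \<open>{0..<1}\<close>, which is
  connected and has 1 in its closure. Stars of such half-open arcs are used below.\<close>

lemma in_closure_arc_minus_end:
  assumes "arc g" "pathfinish g = b"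
  shows "b \<in> closure (path_image g - {b})" "topological_space_class.connected (path_image g - {b})"
proof -
  have "inj_on g {0..1}" "continuous_on {0..1} g" and b: "g 1 = b"
    using assms by (auto simp: arc_def path_def pathfinish_def)
  then have "g ` ({0..1} - {1}) = g ` {0..1} - g ` {1}"
    by (intro inj_on_image_set_diff) auto
  moreover have "{0..1} - {1} = {0..<1::real}" by auto
  ultimately have eq: "path_image g - {b} = g ` {0..<1}"
    using b by (simp add: path_image_def)
  show "topological_space_class.connected (path_image g - {b})"
    unfolding eq by (intro connected_continuous_image continuous_on_subset[OF \<open>continuous_on {0..1} g\<close>]) auto
  have "closure {0..<1::real} = {0..1}" by simp
  then have "g ` closure {0..<1} \<subseteq> closure (g ` {0..<1})"
    using \<open>continuous_on {0..1} g\<close> by (intro image_closure_subset) (auto simp: closure_subset)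
  then show "b \<in> closure (path_image g - {b})"
    unfolding eq using b by auto
qed

text \<open>
  The arcs through two of the vertices \<open>A i\<close> form a theta curve; the star of the third one, without
  its end points, is connected and off the theta curve, but accumulates at all three of its arcs.
\<close>

lemma no_K33_arcs:
  fixes g :: "nat \<Rightarrow> nat \<Rightarrow> real \<Rightarrow> complex"
  assumes arc: "\<And>i j. i < 3 \<Longrightarrow> j < 3 \<Longrightarrow> arc (g i j)"
    and start: "\<And>i j. i < 3 \<Longrightarrow> j < 3 \<Longrightarrow> pathstart (g i j) = A i"
    and finish: "\<And>i j. i < 3 \<Longrightarrow> j < 3 \<Longrightarrow> pathfinish (g i j) = B j"
    and int: "\<And>i j k l. i < 3 \<Longrightarrow> j < 3 \<Longrightarrow> k < 3 \<Longrightarrow> l < 3 \<Longrightarrow> (i, j) \<noteq> (k, l) \<Longrightarrow>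
        path_image (g i j) \<inter> path_image (g k l) \<subseteq>
          (if i = k then {A i} else {}) \<union> (if j = l then {B j} else {})"
  shows False
proof -
  define G where "G i j = path_image (g i j)" for i j
  have A: "A i \<in> G i j" and B: "B j \<in> G i j" and AB: "A i \<noteq> B j" if "i < 3" "j < 3" for i j
    using that arc start finish pathstart_in_path_image[of "g i j"] pathfinish_in_path_image[of "g i j"]
      arc_distinct_ends[of "g i j"] by (auto simp: G_def)
  have disj: "G i j \<inter> G k l = {}" if "i < 3" "j < 3" "k < 3" "l < 3" "i \<noteq> k" "j \<noteq> l" for i j k l
    using int[of i j k l] that by (auto simp: G_def)
  have meetB: "G i j \<inter> G k j = {B j}" if "i < 3" "j < 3" "k < 3" "i \<noteq> k" for i j k
    using int[of i j k j] B[of i j] B[of k j] that by (auto simp: G_def)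
  have meetA: "G i j \<inter> G i k = {A i}" if "i < 3" "j < 3" "k < 3" "j \<noteq> k" for i j k
    using int[of i j i k] A[of i j] A[of i k] that by (auto simp: G_def)
  \<comment> \<open>\<open>c j\<close> runs from \<open>A 0\<close> through \<open>B j\<close> to
    \<open>A 1\<close>.\<close>
  define c where "c j = g 0 j +++ reversepath (g 1 j)" for j
  have c: "arc (c j)" "pathstart (c j) = A 0" "pathfinish (c j) = A 1" "path_image (c j) = G 0 j \<union> G 1 j"
    if "j < 3" for j
    using that arc start finish meetB[of 0 j 1]
    by (auto simp: c_def G_def path_image_join arc_reversepath intro!: arc_join)
  have cint: "path_image (c j) \<inter> path_image (c k) = {A 0, A 1}" if "j < 3" "k < 3" "j \<noteq> k" for j k
  proof -
    have "G 0 j \<inter> G 0 k = {A 0}" "G 1 j \<inter> G 1 k = {A 1}" "G 0 j \<inter> G 1 k = {}" "G 1 j \<inter> G 0 k = {}"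
      using that meetA disj by simp_all
    then show ?thesis unfolding c(4)[OF that(1)] c(4)[OF that(2)] by blast
  qed
  define X where "X = (\<Union>j<3. G 2 j - {B j})"
  have conX: "topological_space_class.connected X"
    unfolding X_def
  proof (rule connected_Union[of "(\<lambda>j. G 2 j - {B j}) ` {..<3}"])
    show "topological_space_class.connected S" if S: "S \<in> (\<lambda>j. G 2 j - {B j}) ` {..<3}" for S
    proof -
      obtain j where "j < 3" "S = G 2 j - {B j}" using S by blast
      then show ?thesis
        using in_closure_arc_minus_end(2)[OF arc[of 2 j] finish[of 2 j]] by (simp add: G_def)
    qed
    have "A 2 \<in> \<Inter> ((\<lambda>j. G 2 j - {B j}) ` {..<3})" using A AB by auto
    then show "\<Inter> ((\<lambda>j. G 2 j - {B j}) ` {..<3}) \<noteq> {}" by blast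
  qed
  have lim: "B j \<in> closure X" if "j < 3" for j
  proof -
    have "B j \<in> closure (G 2 j - {B j})"
      using in_closure_arc_minus_end(1)[OF arc[of 2 j] finish[of 2 j]] that by (simp add: G_def)
    moreover have "G 2 j - {B j} \<subseteq> X" using that by (auto simp: X_def)
    ultimately show ?thesis using closure_mono by blast
  qed
  have away: "X \<inter> path_image (c j) = {}" if "j < 3" for j
  proof -
    have "(G 2 k - {B k}) \<inter> (G 0 j \<union> G 1 j) = {}" if "k < 3" for k
    proof (cases "k = j")
      case True
      then show ?thesis using meetB[of 2 j 0] meetB[of 2 j 1] \<open>j < 3\<close> by auto
    next
      case False
      then show ?thesis using disj[of 2 k 0 j] disj[of 2 k 1 j] \<open>j < 3\<close> \<open>k < 3\<close> by auto
    qed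
    then show ?thesis using c(4)[OF that] by (auto simp: X_def)
  qed
  have on: "B j \<in> path_image (c j) - {A 0, A 1}" if "j < 3" for j
    using c(4)[OF that] B[of 0 j] AB[of 0 j] AB[of 1 j] that by simp
  have less: "0 < (3::nat)" "1 < (3::nat)" "2 < (3::nat)" by auto
  show False
  proof (rule theta_face)
    show "arc (c 0)" "arc (c 1)" "arc (c 2)"
      and "pathstart (c 0) = A 0" "pathstart (c 1) = A 0" "pathstart (c 2) = A 0"
      and "pathfinish (c 0) = A 1" "pathfinish (c 1) = A 1" "pathfinish (c 2) = A 1"
      using c less by blast+
    show "path_image (c 0) \<inter> path_image (c 1) = {A 0, A 1}"
      and "path_image (c 0) \<inter> path_image (c 2) = {A 0, A 1}"
      and "path_image (c 1) \<inter> path_image (c 2) = {A 0, A 1}"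
      by (rule cint; simp)+
    show "topological_space_class.connected X" by (rule conX)
    show "X \<inter> (path_image (c 0) \<union> path_image (c 1) \<union> path_image (c 2)) = {}"
      using away[OF less(1)] away[OF less(2)] away[OF less(3)] by blast
    show "B 0 \<in> closure X" "B 1 \<in> closure X" "B 2 \<in> closure X"
      using lim less by blast+
    show "B 0 \<in> path_image (c 0) - {A 0, A 1}" "B 1 \<in> path_image (c 1) - {A 0, A 1}"
      "B 2 \<in> path_image (c 2) - {A 0, A 1}"
      using on less by blast+
  qed
qed

section \<open>Plane drawings\<close>

text \<open>Pulls a drawing back along an injective graph homomorphism. It serves both directions of
  the theorem: a cube is drawn from a Bruhat graph, and a Bruhat graph from a cube.\<close>

lemma plane_drawing_subgraph:
  assumes draw: "plane_drawing V E pos curve"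
    and f: "inj_on f V'" "f ` V' \<subseteq> V"
    and E': "\<And>e. e \<in> E' \<Longrightarrow> e \<subseteq> V' \<and> f ` e \<in> E"
  shows "plane_drawing V' E' (pos \<circ> f) (\<lambda>e. curve (f ` e))"
  unfolding plane_drawing_def
proof (intro conjI ballI impI)
  have d: "inj_on pos V" and e: "\<And>e. e \<in> E \<Longrightarrow> simple_path (curve e) \<and>
        {pathstart (curve e), pathfinish (curve e)} = pos ` e \<and>
        path_image (curve e) \<inter> pos ` V = pos ` e"
    and ef: "\<And>e f. e \<in> E \<Longrightarrow> f \<in> E \<Longrightarrow> e \<noteq> f \<Longrightarrow>
        path_image (curve e) \<inter> path_image (curve f) \<subseteq> pos ` V"
    using draw unfolding plane_drawing_def by blast+
  show "inj_on (pos \<circ> f) V'"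
    using d f by (meson comp_inj_on inj_on_subset)
  fix g assume g: "g \<in> E'"
  show "simple_path (curve (f ` g))"
    using e E' g by blast
  show "{pathstart (curve (f ` g)), pathfinish (curve (f ` g))} = (pos \<circ> f) ` g"
    using e E' g by (metis image_comp)
  have i: "path_image (curve (f ` g)) \<inter> pos ` V = pos ` f ` g"
    using e E' g by blast
  show "path_image (curve (f ` g)) \<inter> (pos \<circ> f) ` V' = (pos \<circ> f) ` g"
  proof
    show "path_image (curve (f ` g)) \<inter> (pos \<circ> f) ` V' \<subseteq> (pos \<circ> f) ` g"
      using i f(2) unfolding image_comp[symmetric] by blast
    show "(pos \<circ> f) ` g \<subseteq> path_image (curve (f ` g)) \<inter> (pos \<circ> f) ` V'"
      using i E'[OF g] unfolding image_comp[symmetric] by blast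
  qed
  fix h assume h: "h \<in> E'" "g \<noteq> h"
  then have "f ` g \<noteq> f ` h"
    using f(1) E' g by (metis inj_on_image_eq_iff)
  \<comment> \<open>A common point is so far only known to be a vertex of the large graph. Lying on
    the first curve, it is one of the two ends of that curve, hence the position of a vertex in
    \<open>V'\<close>.\<close>
  then have "path_image (curve (f ` g)) \<inter> path_image (curve (f ` h)) \<subseteq> pos ` V"
    using ef E' g h by blast
  then have "path_image (curve (f ` g)) \<inter> path_image (curve (f ` h)) \<subseteq> pos ` f ` g"
    using i by blast
  then show "path_image (curve (f ` g)) \<inter> path_image (curve (f ` h)) \<subseteq> (pos \<circ> f) ` V'"
    using E'[OF g] unfolding image_comp[symmetric] by blast
qed

text \<open>A common point of two curves is a vertex, and a curve passes through no vertex except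
  its own ends.\<close>

lemma plane_drawing_edges_meet:
  assumes draw: "plane_drawing V E pos curve"
    and "e \<in> E" "f \<in> E" "e \<noteq> f" "e \<subseteq> V" "f \<subseteq> V"
  shows "path_image (curve e) \<inter> path_image (curve f) \<subseteq> pos ` (e \<inter> f)"
proof -
  have "inj_on pos V" and e: "path_image (curve e) \<inter> pos ` V = pos ` e"
    and f: "path_image (curve f) \<inter> pos ` V = pos ` f"
    and ef: "path_image (curve e) \<inter> path_image (curve f) \<subseteq> pos ` V"
    using draw assms(2-4) by (simp_all add: plane_drawing_def)
  have "path_image (curve e) \<inter> path_image (curve f) \<subseteq> pos ` e \<inter> pos ` f"
    unfolding e[symmetric] f[symmetric] using ef by (meson Int_greatest Int_lower1 Int_lower2)
  also have "\<dots> = pos ` (e \<inter> f)"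
    by (rule inj_on_image_Int[OF \<open>inj_on pos V\<close> assms(5,6), symmetric])
  finally show ?thesis .
qed

text \<open>Curves are indexed by unordered edges and have an unknown orientation; reversal gives
  the wanted one. As the ends differ, the simple path is an arc.\<close>

lemma plane_drawing_edge_arc:
  assumes draw: "plane_drawing V E pos curve" and e: "{x, y} \<in> E" "x \<noteq> y" "x \<in> V" "y \<in> V"
  obtains g where "arc g" "pathstart g = pos x" "pathfinish g = pos y"
    "path_image g = path_image (curve {x, y})"
proof -
  let ?c = "curve {x, y}"
  have "simple_path ?c" "{pathstart ?c, pathfinish ?c} = {pos x, pos y}" "pos x \<noteq> pos y"
    using draw e unfolding plane_drawing_def by (auto dest: inj_onD)
  then have c: "arc ?c"
    "pathstart ?c = pos x \<and> pathfinish ?c = pos y \<or> pathstart ?c = pos y \<and> pathfinish ?c = pos x"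
    by (auto simp: doubleton_eq_iff arc_simple_path)
  from c(2) show thesis
  proof
    assume "pathstart ?c = pos x \<and> pathfinish ?c = pos y"
    then show thesis using c(1) that[of ?c] by simp
  next
    assume "pathstart ?c = pos y \<and> pathfinish ?c = pos x"
    then show thesis using c(1) that[of "reversepath ?c"] by (simp add: arc_reversepath)
  qed
qed

section \<open>Paths in a drawing and subdivisions of K_{3,3}\<close>

fun path_edges :: "'a list \<Rightarrow> 'a set set" where
  "path_edges (x # y # zs) = insert {x, y} (path_edges (y # zs))"
| "path_edges xs = {}"

lemma path_edges_subset: "e \<in> path_edges xs \<Longrightarrow> e \<subseteq> set xs"
  by (induction xs rule: path_edges.induct) auto

lemma path_edges_doubleton:
  "distinct xs \<Longrightarrow> e \<in> path_edges xs \<Longrightarrow> \<exists>u v. e = {u, v} \<and> u \<noteq> v"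
  by (induction xs rule: path_edges.induct) auto

text \<open>Induction along the path: the first curve meets the later ones only at
  \<open>pos y\<close>, because \<open>x\<close> does not occur again, so the join is still an
  arc.\<close>

lemma plane_drawing_path_arc:
  assumes draw: "plane_drawing V E pos curve"
    and "distinct xs" "2 \<le> length xs" "set xs \<subseteq> V" "path_edges xs \<subseteq> E"
  shows "\<exists>g. arc g \<and> pathstart g = pos (hd xs) \<and> pathfinish g = pos (last xs) \<and>
    path_image g = (\<Union>e\<in>path_edges xs. path_image (curve e))"
  using assms(2-5)
proof (induction xs rule: path_edges.induct)
  case (1 x y zs)
  obtain g where g: "arc g" "pathstart g = pos x" "pathfinish g = pos y"
    "path_image g = path_image (curve {x, y})"
    using 1 plane_drawing_edge_arc[OF draw, of x y] by auto
  show ?case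
  proof (cases zs)
    case Nil
    then show ?thesis using g by (intro exI[of _ g]) auto
  next
    case (Cons z ws)
    obtain h where h: "arc h" "pathstart h = pos y" "pathfinish h = pos (last (y # zs))"
      "path_image h = (\<Union>e\<in>path_edges (y # zs). path_image (curve e))"
      using 1 Cons by auto
    have "path_image (curve {x, y}) \<inter> path_image (curve e) \<subseteq> {pos y}"
      if e: "e \<in> path_edges (y # zs)" for e
    proof -
      have "e \<subseteq> set (y # zs)" using path_edges_subset[OF e] .
      then have "x \<notin> e" using 1 by auto
      have "path_image (curve {x, y}) \<inter> path_image (curve e) \<subseteq> pos ` ({x, y} \<inter> e)"
        using \<open>x \<notin> e\<close> \<open>e \<subseteq> set (y # zs)\<close> e 1
        by (intro plane_drawing_edges_meet[OF draw]) auto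
      then show ?thesis using \<open>x \<notin> e\<close> by auto
    qed
    then have "arc (g +++ h)"
      using g h by (intro arc_join) auto
    then show ?thesis
      using g h Cons by (intro exI[of _ "g +++ h"]) (auto simp: path_image_join)
  qed
qed auto

lemma no_plane_K33_subdivision:
  fixes p :: "nat \<Rightarrow> nat \<Rightarrow> 'a list"
  assumes draw: "plane_drawing V E pos curve"
    and p: "\<And>i j. i < 3 \<Longrightarrow> j < 3 \<Longrightarrow> distinct (p i j) \<and> 2 \<le> length (p i j) \<and> set (p i j) \<subseteq> V \<and>
        path_edges (p i j) \<subseteq> E \<and> hd (p i j) = a i \<and> last (p i j) = b j"
    and disj: "\<And>i j k l. i < 3 \<Longrightarrow> j < 3 \<Longrightarrow> k < 3 \<Longrightarrow> l < 3 \<Longrightarrow> (i, j) \<noteq> (k, l) \<Longrightarrow>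
        set (p i j) \<inter> set (p k l) \<subseteq> (if i = k then {a i} else {}) \<union> (if j = l then {b j} else {})"
  shows False
proof -
  have "\<exists>g. arc g \<and> pathstart g = pos (a i) \<and> pathfinish g = pos (b j) \<and>
      path_image g = (\<Union>e\<in>path_edges (p i j). path_image (curve e))" if "i < 3" "j < 3" for i j
    using plane_drawing_path_arc[OF draw, of "p i j"] p[OF that] by auto
  then obtain g where g: "\<And>i j. i < 3 \<Longrightarrow> j < 3 \<Longrightarrow> arc (g i j) \<and> pathstart (g i j) = pos (a i) \<and>
      pathfinish (g i j) = pos (b j) \<and>
      path_image (g i j) = (\<Union>e\<in>path_edges (p i j). path_image (curve e))"
    by metis
  have meet: "path_image (g i j) \<inter> path_image (g k l) \<subseteq>
      (if i = k then {pos (a i)} else {}) \<union> (if j = l then {pos (b j)} else {})"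
    if ij: "i < 3" "j < 3" "k < 3" "l < 3" "(i, j) \<noteq> (k, l)" for i j k l
  proof
    fix z assume "z \<in> path_image (g i j) \<inter> path_image (g k l)"
    then obtain e f where e: "e \<in> path_edges (p i j)" "z \<in> path_image (curve e)"
      and f: "f \<in> path_edges (p k l)" "z \<in> path_image (curve f)"
      using g ij by auto
    have sub: "e \<subseteq> set (p i j)" "f \<subseteq> set (p k l)"
      using e f path_edges_subset by auto
    note D = disj[OF ij]
    \<comment> \<open>Two different paths share at most one vertex, while an edge has two.\<close>
    have "e \<noteq> f"
    proof
      assume "e = f"
      moreover obtain u v where "e = {u, v}" "u \<noteq> v"
        using path_edges_doubleton[OF _ e(1)] p ij by auto
      ultimately have "u \<in> set (p i j) \<inter> set (p k l)" "v \<in> set (p i j) \<inter> set (p k l)" "u \<noteq> v"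
        using sub by auto
      then show False using D ij(5) by (auto split: if_splits)
    qed
    then have "z \<in> pos ` (e \<inter> f)"
      using plane_drawing_edges_meet[OF draw, of e f] e f p[OF ij(1,2)] p[OF ij(3,4)] sub by blast
    then have "z \<in> pos ` (set (p i j) \<inter> set (p k l))" using sub by blast
    then show "z \<in> (if i = k then {pos (a i)} else {}) \<union> (if j = l then {pos (b j)} else {})"
      using D by (auto split: if_splits)
  qed
  show False
  proof (rule no_K33_arcs[of g "\<lambda>i. pos (a i)" "\<lambda>j. pos (b j)"])
    fix i j :: nat assume "i < 3" "j < 3"
    then show "arc (g i j)" "pathstart (g i j) = pos (a i)" "pathfinish (g i j) = pos (b j)"
      using g by blast+
  qed (use meet in blast)
qed

lemma no_plane_K33:
  assumes draw: "plane_drawing V E pos curve"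
    and xs: "length xs = 3" "length ys = 3" "distinct (xs @ ys)" "set xs \<union> set ys \<subseteq> V"
    and E: "\<And>x y. x \<in> set xs \<Longrightarrow> y \<in> set ys \<Longrightarrow> {x, y} \<in> E"
  shows False
proof (rule no_plane_K33_subdivision[OF draw, of "\<lambda>i j. [xs ! i, ys ! j]" "(!) xs" "(!) ys"])
  fix i j :: nat assume ij: "i < 3" "j < 3"
  then have "xs ! i \<in> set xs" "ys ! j \<in> set ys" using xs by auto
  then show "distinct [xs ! i, ys ! j] \<and> 2 \<le> length [xs ! i, ys ! j] \<and> set [xs ! i, ys ! j] \<subseteq> V \<and>
      path_edges [xs ! i, ys ! j] \<subseteq> E \<and> hd [xs ! i, ys ! j] = xs ! i \<and> last [xs ! i, ys ! j] = ys ! j"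
    using E xs by auto
  fix k l :: nat assume kl: "k < 3" "l < 3" "(i, j) \<noteq> (k, l)"
  then have "xs ! k \<in> set xs" "ys ! l \<in> set ys" using xs by auto
  then have "xs ! i \<noteq> ys ! l" "xs ! k \<noteq> ys ! j"
    using \<open>xs ! i \<in> set xs\<close> \<open>ys ! j \<in> set ys\<close> xs by auto
  then show "set [xs ! i, ys ! j] \<inter> set [xs ! k, ys ! l] \<subseteq>
      (if i = k then {xs ! i} else {}) \<union> (if j = l then {ys ! j} else {})"
    using ij kl xs by (auto simp: nth_eq_iff_index_eq)
qed

section \<open>The four-dimensional cube is not planar\<close>

text \<open>The hypercube graph on \<open>Pow S\<close>, that is, the Hasse diagram of the Boolean
  lattice.\<close>

definition cube_edges :: "'a set \<Rightarrow> 'a set set set" where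
  "cube_edges S = {{A, insert x A} |A x. A \<subseteq> S \<and> x \<in> S - A}"

lemma cube_edgeI:
  "X \<subseteq> S \<and> (\<exists>x\<in>S - X. Y = insert x X) \<or> Y \<subseteq> S \<and> (\<exists>x\<in>S - Y. X = insert x Y) \<Longrightarrow> {X, Y} \<in> cube_edges S"
  unfolding cube_edges_def by blast

lemma no_plane_cube4: "\<not> plane_drawing (Pow {0, 1, 2, 3}) (cube_edges {0, 1, 2, 3::nat}) pos curve"
proof
  assume draw: "plane_drawing (Pow {0, 1, 2, 3}) (cube_edges {0, 1, 2, 3::nat}) pos curve"
  \<comment> \<open>row \<open>i\<close>, column \<open>j\<close>: the path from \<open>a ! i\<close> to \<open>b ! j\<close> in a subdivided $K_{3,3}$, found by search\<close>
  define p :: "nat set list list list" where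
    "p = [[[{}, {1}],         [{}, {2}],         [{}, {3}]],
          [[{0}, {0, 1}, {1}], [{0}, {0, 2}, {2}], [{0}, {0, 3}, {3}]],
          [[{1, 2}, {1}],     [{1, 2}, {2}],     [{1, 2}, {1, 2, 3}, {2, 3}, {3}]]]"
  define a where "a = [{}, {0}, {1, 2::nat}]"
  define b where "b = [{1}, {2}, {3::nat}]"
  \<comment> \<open>The edge relation of the cube with bounded quantifiers only, so that the
    properties of the table can be decided by evaluation.\<close>
  define adj where "adj X Y \<longleftrightarrow> X \<subseteq> {0, 1, 2, 3} \<and> (\<exists>x\<in>{0, 1, 2, 3} - X. Y = insert x X) \<or>
      Y \<subseteq> {0, 1, 2, 3} \<and> (\<exists>x\<in>{0, 1, 2, 3::nat} - Y. X = insert x Y)" for X Y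
  have path: "path_edges xs \<subseteq> cube_edges {0, 1, 2, 3}" if "successively adj xs" for xs
    using that
    by (induction xs rule: path_edges.induct) (auto simp: adj_def intro!: cube_edgeI)
  have 1: "\<forall>i\<in>{..<3}. \<forall>j\<in>{..<3}. distinct (p ! i ! j) \<and> 2 \<le> length (p ! i ! j) \<and>
      set (p ! i ! j) \<subseteq> Pow {0, 1, 2, 3} \<and> successively adj (p ! i ! j) \<and>
      hd (p ! i ! j) = a ! i \<and> last (p ! i ! j) = b ! j"
    unfolding p_def a_def b_def adj_def by code_simp
  have 2: "\<forall>i\<in>{..<3}. \<forall>j\<in>{..<3}. \<forall>k\<in>{..<3}. \<forall>l\<in>{..<3}. (i, j) \<noteq> (k, l) \<longrightarrow>
      set (p ! i ! j) \<inter> set (p ! k ! l) \<subseteq>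
        (if i = k then {a ! i} else {}) \<union> (if j = l then {b ! j} else {})"
    unfolding p_def a_def b_def by code_simp
  show False
  proof (rule no_plane_K33_subdivision[OF draw, of "\<lambda>i j. p ! i ! j" "(!) a" "(!) b"])
    fix i j :: nat assume "i < 3" "j < 3"
    with 1 have "distinct (p ! i ! j) \<and> 2 \<le> length (p ! i ! j) \<and>
      set (p ! i ! j) \<subseteq> Pow {0, 1, 2, 3} \<and> successively adj (p ! i ! j) \<and>
      hd (p ! i ! j) = a ! i \<and> last (p ! i ! j) = b ! j" by blast
    moreover from this have "path_edges (p ! i ! j) \<subseteq> cube_edges {0, 1, 2, 3}"
      by (intro path) simp
    ultimately show "distinct (p ! i ! j) \<and> 2 \<le> length (p ! i ! j) \<and>
      set (p ! i ! j) \<subseteq> Pow {0, 1, 2, 3} \<and> path_edges (p ! i ! j) \<subseteq> cube_edges {0, 1, 2, 3} \<and>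
      hd (p ! i ! j) = a ! i \<and> last (p ! i ! j) = b ! j" by simp
  qed (use 2 in blast)
qed

section \<open>A straight-line drawing of the three-dimensional cube\<close>

text \<open>A segment is the convex hull of its ends, so a straight-line drawing is verified by
  statements about convex hulls; \<open>card e = 2\<close> rules out loops.\<close>

lemma straight_line_drawing:
  assumes pos: "inj_on pos V"
    and E: "\<And>e. e \<in> E \<Longrightarrow> card e = 2 \<and> e \<subseteq> V \<and> convex hull (pos ` e) \<inter> pos ` V \<subseteq> pos ` e"
    and cross: "\<And>e f. e \<in> E \<Longrightarrow> f \<in> E \<Longrightarrow> e \<noteq> f \<Longrightarrow>
        convex hull (pos ` e) \<inter> convex hull (pos ` f) \<subseteq> pos ` V"
  shows "\<exists>curve. plane_drawing V E pos curve"
proof -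
  have "\<exists>g. simple_path g \<and> {pathstart g, pathfinish g} = pos ` e \<and> path_image g = convex hull (pos ` e)"
    if "e \<in> E" for e
  proof -
    obtain x y where e: "e = {x, y}" "x \<noteq> y" using E[OF \<open>e \<in> E\<close>] by (auto simp: card_2_iff)
    then have "pos x \<noteq> pos y" using pos E[OF \<open>e \<in> E\<close>] by (auto dest: inj_onD)
    then show ?thesis using e
      by (intro exI[of _ "linepath (pos x) (pos y)"])
        (simp add: arc_imp_simple_path segment_convex_hull)
  qed
  then obtain curve where "\<And>e. e \<in> E \<Longrightarrow> simple_path (curve e) \<and>
      {pathstart (curve e), pathfinish (curve e)} = pos ` e \<and> path_image (curve e) = convex hull (pos ` e)"
    by metis
  moreover have "convex hull (pos ` e) \<inter> pos ` V = pos ` e" if "e \<in> E" for e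
    using E[OF that] hull_subset[of "pos ` e" convex] by blast
  ultimately have "plane_drawing V E pos curve"
    using pos cross unfolding plane_drawing_def by simp
  then show ?thesis by blast
qed

text \<open>Two nested squares with corners $(\pm 2, \pm 2)$ and $(\pm 1, \pm 1)$; the bit \<open>2\<close> selects the inner one.\<close>

definition cube3_pos :: "nat set \<Rightarrow> complex" where
  "cube3_pos A = (let r = if 2 \<in> A then 1 else 2 in
     Complex (if 0 \<in> A then r else - r) (if 1 \<in> A then r else - r))"

lemma cube3_pos_abs:
  "\<bar>Re (cube3_pos A)\<bar> = \<bar>Im (cube3_pos A)\<bar>" "\<bar>Im (cube3_pos A)\<bar> = 1 \<or> \<bar>Im (cube3_pos A)\<bar> = 2"
  by (simp_all add: cube3_pos_def Let_def)

text \<open>Adding 0 or 1 reflects, which gives the sides of the squares; adding 2 halves the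
  vector, which gives the diagonal spokes. The first and third equations recover a position from one
  coordinate and so tell parallel sides apart.\<close>

lemma cube3_pos_insert:
  "0 \<notin> A \<Longrightarrow> Re (cube3_pos A) = - \<bar>Im (cube3_pos A)\<bar>"
  "0 \<notin> A \<Longrightarrow> cube3_pos (insert 0 A) = Complex (- Re (cube3_pos A)) (Im (cube3_pos A))"
  "1 \<notin> A \<Longrightarrow> Im (cube3_pos A) = - \<bar>Re (cube3_pos A)\<bar>"
  "1 \<notin> A \<Longrightarrow> cube3_pos (insert 1 A) = Complex (Re (cube3_pos A)) (- Im (cube3_pos A))"
  "2 \<notin> A \<Longrightarrow> \<bar>Re (cube3_pos A)\<bar> = 2"
  "2 \<notin> A \<Longrightarrow> cube3_pos (insert 2 A) = Complex (Re (cube3_pos A) / 2) (Im (cube3_pos A) / 2)"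
  by (simp_all add: cube3_pos_def Let_def)

lemma inj_on_cube3_pos: "inj_on cube3_pos (Pow {0, 1, 2})"
proof (rule inj_onI)
  fix A B :: "nat set" assume AB: "A \<in> Pow {0, 1, 2}" "B \<in> Pow {0, 1, 2}" "cube3_pos A = cube3_pos B"
  have A: "0 \<in> A \<longleftrightarrow> Re (cube3_pos A) > 0" "1 \<in> A \<longleftrightarrow> Im (cube3_pos A) > 0"
    "2 \<in> A \<longleftrightarrow> \<bar>Re (cube3_pos A)\<bar> = 1" for A
    by (simp_all add: cube3_pos_def Let_def)
  have "x \<in> A \<longleftrightarrow> x \<in> B" if "x \<in> {0, 1, 2}" for x
    using that A[of A] A[of B] AB(3) by auto
  then show "A = B" using AB(1,2) by blast
qed

text \<open>Makes being a vertex an arithmetic condition, which is all that has to be checked at a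
  crossing.\<close>

lemma cube3_pos_surj:
  assumes "\<bar>Re z\<bar> = \<bar>Im z\<bar>" "\<bar>Im z\<bar> = 1 \<or> \<bar>Im z\<bar> = 2"
  shows "z \<in> cube3_pos ` Pow {0, 1, 2}"
proof -
  define A :: "nat set" where
    "A = (if Re z > 0 then {0} else {}) \<union> (if Im z > 0 then {1} else {}) \<union> (if \<bar>Im z\<bar> = 1 then {2} else {})"
  have "z = cube3_pos A"
    using assms by (auto simp: A_def cube3_pos_def complex_eq_iff)
  moreover have "A \<in> Pow {0, 1, 2}" by (auto simp: A_def)
  ultimately show ?thesis by blast
qed

lemma convex_hull_complex_2D:
  assumes "z \<in> convex hull {a, b}"
  obtains u where "0 \<le> u" "u \<le> 1" "Re z = Re a + u * (Re b - Re a)" "Im z = Im a + u * (Im b - Im a)"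
proof -
  from assms obtain u where u: "0 \<le> u" "u \<le> 1" and z: "z = (1 - u) *\<^sub>R a + u *\<^sub>R b"
    unfolding segment_convex_hull[symmetric] in_segment by blast
  show thesis by (rule that[OF u]) (simp_all add: z algebra_simps)
qed

text \<open>Segments are replaced by conditions on coordinates: on a side, one coordinate is fixed
  and bounds the other; a point of a spoke is a multiple of its outer corner. These suffice to
  locate all crossings.\<close>

lemma cube3_edge_region:
  assumes z: "z \<in> convex hull (cube3_pos ` {A, insert x A})" and "x \<notin> A"
  shows "x = 0 \<Longrightarrow> Im z = Im (cube3_pos A) \<and> \<bar>Re z\<bar> \<le> \<bar>Im (cube3_pos A)\<bar>"
    and "x = 1 \<Longrightarrow> Re z = Re (cube3_pos A) \<and> \<bar>Im z\<bar> \<le> \<bar>Re (cube3_pos A)\<bar>"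
    and "x = 2 \<Longrightarrow> \<exists>t. 1 / 2 \<le> t \<and> t \<le> 1 \<and> Re z = t * Re (cube3_pos A) \<and> Im z = t * Im (cube3_pos A)"
proof -
  let ?p = "cube3_pos A" and ?q = "cube3_pos (insert x A)"
  obtain u where u: "0 \<le> u" "u \<le> 1" "Re z = Re ?p + u * (Re ?q - Re ?p)"
    "Im z = Im ?p + u * (Im ?q - Im ?p)"
    using convex_hull_complex_2D[of z ?p ?q] z by auto
  have le: "\<bar>(1 - 2 * u) * r\<bar> \<le> \<bar>r\<bar>" for r :: real
    using mult_right_mono[of "\<bar>1 - 2 * u\<bar>" 1 "\<bar>r\<bar>"] u(1,2) by (simp add: abs_mult)
  show "Im z = Im ?p \<and> \<bar>Re z\<bar> \<le> \<bar>Im ?p\<bar>" if "x = 0"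
  proof -
    have q: "?q = Complex (- Re ?p) (Im ?p)" using cube3_pos_insert(2) assms(2) that by simp
    have "Re z = (1 - 2 * u) * Re ?p" using u(3) by (simp add: q algebra_simps)
    then show ?thesis using u(4) le[of "Re ?p"] cube3_pos_abs(1)[of A] by (simp add: q)
  qed
  show "Re z = Re ?p \<and> \<bar>Im z\<bar> \<le> \<bar>Re ?p\<bar>" if "x = 1"
  proof -
    have q: "?q = Complex (Re ?p) (- Im ?p)" using cube3_pos_insert(4) assms(2) that by simp
    have "Im z = (1 - 2 * u) * Im ?p" using u(4) by (simp add: q algebra_simps)
    then show ?thesis using u(3) le[of "Im ?p"] cube3_pos_abs(1)[of A] by (simp add: q)
  qed
  show "\<exists>t. 1 / 2 \<le> t \<and> t \<le> 1 \<and> Re z = t * Re ?p \<and> Im z = t * Im ?p" if "x = 2"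
  proof -
    have q: "?q = Complex (Re ?p / 2) (Im ?p / 2)" using cube3_pos_insert(6) assms(2) that by simp
    \<comment> \<open>The spoke ends at half of \<open>?p\<close>, hence the factor
      \<open>1 - u / 2\<close>.\<close>
    show ?thesis
      using u by (intro exI[of _ "1 - u / 2"]) (simp add: q algebra_simps)
  qed
qed

lemma ex_plane_drawing_cube3:
  "\<exists>curve. plane_drawing (Pow {0, 1, 2}) (cube_edges {0, 1, 2}) cube3_pos curve"
proof (rule straight_line_drawing)
  show "inj_on cube3_pos (Pow {0, 1, 2})" by (rule inj_on_cube3_pos)
  have edge: "\<exists>A x. e = {A, insert x A} \<and> A \<subseteq> {0, 1, 2} \<and> x \<notin> A \<and> (x = 0 \<or> x = 1 \<or> x = 2)"
    if "e \<in> cube_edges {0, 1, 2::nat}" for e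
    using that unfolding cube_edges_def by blast
  show "card e = 2 \<and> e \<subseteq> Pow {0, 1, 2} \<and> convex hull (cube3_pos ` e) \<inter> cube3_pos ` Pow {0, 1, 2} \<subseteq> cube3_pos ` e"
    if e_edge: "e \<in> cube_edges {0, 1, 2}" for e
  proof -
    obtain A x where e: "e = {A, insert x A}" and A: "A \<subseteq> {0, 1, 2}" and x: "x \<notin> A" "x = 0 \<or> x = 1 \<or> x = 2"
      using edge[OF e_edge] by blast
    have card: "card e = 2" using e x by (auto simp: card_2_iff)
    have sub: "e \<subseteq> Pow {0, 1, 2}" using e A x(2) by auto
    have on: "cube3_pos B \<in> cube3_pos ` e" if B: "cube3_pos B \<in> convex hull (cube3_pos ` e)" for B
    proof -
      let ?p = "cube3_pos A" and ?b = "cube3_pos B"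
      note region = cube3_edge_region[OF B[unfolded e] x(1)]
      have "?b = ?p \<or> ?b = cube3_pos (insert x A)"
        using x(2)
      proof (elim disjE)
        assume "x = 0"
        with region have "Im ?b = Im ?p" by simp
        moreover from this have "Re ?b = Re ?p \<or> Re ?b = - Re ?p"
          using cube3_pos_abs(1)[of A] cube3_pos_abs(1)[of B] by (metis abs_eq_iff)
        ultimately show ?thesis
          using cube3_pos_insert(2)[of A] x \<open>x = 0\<close> by (auto simp: complex_eq_iff)
      next
        assume "x = 1"
        with region have "Re ?b = Re ?p" by simp
        moreover from this have "Im ?b = Im ?p \<or> Im ?b = - Im ?p"
          using cube3_pos_abs(1)[of A] cube3_pos_abs(1)[of B] by (metis abs_eq_iff)
        ultimately show ?thesis
          using cube3_pos_insert(4)[of A] x \<open>x = 1\<close> by (auto simp: complex_eq_iff)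
      next
        assume "x = 2"
        with region obtain t where t: "1 / 2 \<le> t" "t \<le> 1" "Re ?b = t * Re ?p" "Im ?b = t * Im ?p" by auto
        have p: "\<bar>Re ?p\<bar> = 2" using cube3_pos_insert(5) x \<open>x = 2\<close> by simp
        then have "\<bar>Re ?b\<bar> = 2 * t" using t by (simp add: abs_mult)
        \<comment> \<open>The absolute value of a coordinate of a vertex is 1 or 2, which leaves
          only the two ends of the spoke.\<close>
        then have "t = 1 \<or> t = 1 / 2" using cube3_pos_abs[of B] by auto
        then show ?thesis
          using t cube3_pos_insert(6)[of A] x \<open>x = 2\<close> by (elim disjE) (simp_all add: complex_eq_iff)
      qed
      then show ?thesis using e by auto
    qed
    show ?thesis
    proof (intro conjI subsetI card)
      show "B \<in> Pow {0, 1, 2}" if "B \<in> e" for B using sub that by (rule subsetD)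
      fix z assume z: "z \<in> convex hull (cube3_pos ` e) \<inter> cube3_pos ` Pow {0, 1, 2}"
      then obtain B where "z = cube3_pos B" by (elim IntE imageE)
      with z show "z \<in> cube3_pos ` e" using on[of B] by (simp only: Int_iff)
    qed
  qed
  show "convex hull (cube3_pos ` e) \<inter> convex hull (cube3_pos ` f) \<subseteq> cube3_pos ` Pow {0, 1, 2}"
    if edges: "e \<in> cube_edges {0, 1, 2}" "f \<in> cube_edges {0, 1, 2}" and "e \<noteq> f" for e f
  proof
    obtain A x where e: "e = {A, insert x A}" and A: "A \<subseteq> {0, 1, 2}" and x: "x \<notin> A" "x = 0 \<or> x = 1 \<or> x = 2"
      using edge[OF edges(1)] by blast
    obtain B y where f: "f = {B, insert y B}" and B: "B \<subseteq> {0, 1, 2}" and y: "y \<notin> B" "y = 0 \<or> y = 1 \<or> y = 2"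
      using edge[OF edges(2)] by blast
    let ?a = "cube3_pos A" and ?b = "cube3_pos B"
    fix z assume z: "z \<in> convex hull (cube3_pos ` e) \<inter> convex hull (cube3_pos ` f)"
    then have "z \<in> convex hull (cube3_pos ` {A, insert x A})" "z \<in> convex hull (cube3_pos ` {B, insert y B})"
      using e f by auto
    note ra = cube3_edge_region[OF this(1) x(1)] and rb = cube3_edge_region[OF this(2) y(1)]
    have neq: "?a \<noteq> ?b" if "x = y"
    proof
      assume "?a = ?b"
      then have "A = B" using inj_onD[OF inj_on_cube3_pos] A B by blast
      then show False using that \<open>e \<noteq> f\<close> e f by simp
    qed
    have diag: "\<bar>Re z\<bar> = \<bar>Im z\<bar>" if "\<exists>t. 1 / 2 \<le> t \<and> t \<le> 1 \<and> Re z = t * Re c \<and> Im z = t * Im c"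
      "\<bar>Re c\<bar> = \<bar>Im c\<bar>" for c
      using that by (auto simp: abs_mult)
    note abs = cube3_pos_abs[of A] cube3_pos_abs[of B]
    \<comment> \<open>Edges in different directions can meet only where the vertex condition holds.
      Distinct edges in the same direction never meet, since a common point would force
      \<open>?a = ?b\<close>.\<close>
    have "\<bar>Re z\<bar> = \<bar>Im z\<bar> \<and> (\<bar>Im z\<bar> = 1 \<or> \<bar>Im z\<bar> = 2)"
    proof (cases "x = y")
      case False
      then consider "x = 0" "y = 1" | "x = 0" "y = 2" | "x = 1" "y = 0" | "x = 1" "y = 2" | "x = 2" "y = 0" | "x = 2" "y = 1"
        using x y by auto
      then show ?thesis
      proof cases
        case 1 then show ?thesis using ra rb abs by auto
      next
        case 2 then show ?thesis using ra rb abs diag[of ?b] by auto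
      next
        case 3 then show ?thesis using ra rb abs by auto
      next
        case 4 then show ?thesis using ra rb abs diag[of ?b] by auto
      next
        case 5 then show ?thesis using ra rb abs diag[of ?a] by auto
      next
        case 6 then show ?thesis using ra rb abs diag[of ?a] by auto
      qed
    next
      case True
      have False
        using x(2)
      proof (elim disjE)
        assume "x = 0"
        then have "Im ?a = Im ?b" using ra rb True by simp
        moreover from this have "Re ?a = Re ?b" using cube3_pos_insert(1) x(1) y(1) True \<open>x = 0\<close> by simp
        ultimately show False using neq[OF True] by (simp add: complex_eq_iff)
      next
        assume "x = 1"
        then have "Re ?a = Re ?b" using ra rb True by simp
        moreover from this have "Im ?a = Im ?b" using cube3_pos_insert(3) x(1) y(1) True \<open>x = 1\<close> by metis
        ultimately show False using neq[OF True] by (simp add: complex_eq_iff)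
      next
        assume "x = 2"
        then obtain s where s: "1 / 2 \<le> s" "Re z = s * Re ?a" "Im z = s * Im ?a" using ra by auto
        obtain t where t: "1 / 2 \<le> t" "Re z = t * Re ?b" "Im z = t * Im ?b" using rb True \<open>x = 2\<close> by auto
        have ab: "\<bar>Re ?a\<bar> = 2" "\<bar>Re ?b\<bar> = 2" using cube3_pos_insert(5) x(1) y(1) True \<open>x = 2\<close> by simp_all
        have "\<bar>Re z\<bar> = 2 * s" unfolding s(2) abs_mult ab using s(1) by simp
        moreover have "\<bar>Re z\<bar> = 2 * t" unfolding t(2) abs_mult ab using t(1) by simp
        ultimately have "s = t" by simp
        then show False using s t neq[OF True] by (auto simp: complex_eq_iff)
      qed
      then show ?thesis ..
    qed
    then show "z \<in> cube3_pos ` Pow {0, 1, 2}" by (intro cube3_pos_surj) auto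
  qed
qed

section \<open>Reduced words and Bruhat order\<close>

lemma adjacent_product_Nil [simp]: "adjacent_product [] = id"
  and adjacent_product_Cons [simp]:
    "adjacent_product (i # is) = Transposition.transpose i (i + 1) \<circ> adjacent_product is"
  by (simp_all add: adjacent_product_def)

lemma adjacent_product_append: "adjacent_product (u @ v) = adjacent_product u \<circ> adjacent_product v"
  by (induction u) (simp_all add: comp_assoc)

lemma bij_adjacent_product: "bij (adjacent_product w)"
proof (induction w)
  case (Cons i w)
  then show ?case unfolding adjacent_product_Cons by (intro bij_comp) simp_all
qed (simp add: bij_id[unfolded id_def] id_def)

lemma transpose_permutes_Icc: "(i::nat) \<in> {1..<n} \<Longrightarrow> Transposition.transpose i (i + 1) permutes {1..n}"
  by (intro permutes_swap_id) auto

lemma adjacent_product_permutes: "set w \<subseteq> {1..<n} \<Longrightarrow> adjacent_product w permutes {1..n}"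
proof (induction w)
  case (Cons i w)
  then show ?case
    unfolding adjacent_product_Cons by (intro permutes_compose transpose_permutes_Icc) auto
qed (simp add: permutes_id)

text \<open>Induction on the distance: a transposition is a shorter one conjugated by an adjacent
  one.\<close>

lemma ex_adjacent_product_transpose:
  "a \<in> {1..n} \<Longrightarrow> a + d \<in> {1..n} \<Longrightarrow>
    \<exists>w. set w \<subseteq> {1..<n} \<and> Transposition.transpose a (a + d) = adjacent_product w"
proof (induction d)
  case 0
  then show ?case by (intro exI[of _ "[]"]) simp
next
  case (Suc d)
  then obtain w where w: "set w \<subseteq> {1..<n}" "Transposition.transpose a (a + d) = adjacent_product w"
    by auto
  show ?case
  \<comment> \<open>For \<open>d = 0\<close> the conjugate would be the identity, so this case is
    separate.\<close>
  proof (cases "d = 0")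
    case True
    then show ?thesis using Suc by (intro exI[of _ "[a]"]) auto
  next
    case False
    have "Transposition.transpose a (a + Suc d) = Transposition.transpose (a + d) (a + d + 1) \<circ>
        Transposition.transpose a (a + d) \<circ> Transposition.transpose (a + d) (a + d + 1)"
      using False by (auto simp: fun_eq_iff Transposition.transpose_def)
    also have "\<dots> = adjacent_product ((a + d) # w @ [a + d])"
      by (simp add: adjacent_product_append w(2) comp_assoc)
    finally show ?thesis using w(1) Suc by (intro exI[of _ "(a + d) # w @ [a + d]"]) auto
  qed
qed

lemma ex_adjacent_product:
  assumes "\<pi> permutes {1..n}"
  shows "\<exists>w. set w \<subseteq> {1..<n} \<and> \<pi> = adjacent_product w"
  using assms finite_atLeastAtMost
proof (induction rule: permutes_induct)
  case id
  then show ?case by (intro exI[of _ "[]"]) simp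
next
  case (swap a b p)
  obtain w where w: "set w \<subseteq> {1..<n}" "p = adjacent_product w" using swap by blast
  obtain v where "set v \<subseteq> {1..<n}" "Transposition.transpose a b = adjacent_product v"
  proof (cases "a \<le> b")
    case True
    then show thesis using ex_adjacent_product_transpose[of a n "b - a"] swap that by auto
  next
    case False
    then show thesis using ex_adjacent_product_transpose[of b n "a - b"] swap that
      by (auto simp: transpose_commute)
  qed
  then show ?case using w by (intro exI[of _ "v @ w"]) (auto simp: adjacent_product_append)
qed

definition reduced :: "nat \<Rightarrow> nat list \<Rightarrow> bool" where
  "reduced n w \<longleftrightarrow> set w \<subseteq> {1..<n} \<and> perm_length n (adjacent_product w) = length w"

lemma perm_length_le: "set w \<subseteq> {1..<n} \<Longrightarrow> perm_length n (adjacent_product w) \<le> length w"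
  unfolding perm_length_def by (rule Least_le) blast

lemma ex_reduced_word:
  assumes "\<pi> permutes {1..n}"
  obtains w where "reduced n w" "\<pi> = adjacent_product w"
proof -
  have "\<exists>k. \<exists>w. length w = k \<and> set w \<subseteq> {1..<n} \<and> \<pi> = adjacent_product w"
    using ex_adjacent_product[OF assms] by blast
  from LeastI_ex[OF this] obtain w
    where "length w = perm_length n \<pi>" "set w \<subseteq> {1..<n}" "\<pi> = adjacent_product w"
    unfolding perm_length_def by blast
  then show thesis using that[of w] by (simp add: reduced_def)
qed

lemma reducedD: "reduced n w \<Longrightarrow> adjacent_product w = adjacent_product v \<Longrightarrow> set v \<subseteq> {1..<n} \<Longrightarrow>
    length w \<le> length v"
  using perm_length_le[of v n] by (simp add: reduced_def)

text \<open>A shorter word for the middle factor would shorten the whole word.\<close>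

lemma reduced_factor:
  assumes "reduced n (u @ v @ w)" shows "reduced n v"
proof -
  have sub: "set u \<subseteq> {1..<n}" "set v \<subseteq> {1..<n}" "set w \<subseteq> {1..<n}"
    using assms by (auto simp: reduced_def)
  obtain v' where v': "reduced n v'" "adjacent_product v = adjacent_product v'"
    using ex_reduced_word adjacent_product_permutes sub by metis
  have "adjacent_product (u @ v @ w) = adjacent_product (u @ v' @ w)"
    by (simp add: adjacent_product_append v'(2))
  then have "length v \<le> length v'"
    using reducedD[OF assms, of "u @ v' @ w"] sub v'(1) by (auto simp: reduced_def)
  moreover have "length v' \<le> length v"
    using reducedD[OF v'(1), of v] v'(2) sub by simp
  ultimately show ?thesis using v' sub by (simp add: reduced_def)
qed

text \<open>Deleting \<open>x\<close> amounts to multiplying on the right by the conjugate v^-1 s_x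
  v, the transposition of the two positions that \<open>v\<close> sends to \<open>x\<close> and
  \<open>x + 1\<close>.\<close>

lemma adjacent_product_delete:
  assumes "set (u @ x # v) \<subseteq> {1..<n}"
  obtains i j where "i \<in> {1..n}" "j \<in> {1..n}" "i \<noteq> j"
    "adjacent_product (u @ v) = adjacent_product (u @ x # v) \<circ> Transposition.transpose i j"
proof -
  let ?v = "adjacent_product v"
  have p: "?v permutes {1..n}" using assms by (intro adjacent_product_permutes) auto
  have x: "x \<in> {1..n}" "x + 1 \<in> {1..n}" using assms by auto
  define i j where "i = inv ?v x" and "j = inv ?v (x + 1)"
  have ij: "?v i = x" "?v j = x + 1"
    using p by (simp_all add: i_def j_def permutes_inverses)
  have "i \<in> {1..n}" "j \<in> {1..n}"
    using x permutes_in_image[OF p] ij by metis+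
  moreover have "i \<noteq> j" using ij by auto
  moreover have "?v = Transposition.transpose x (x + 1) \<circ> ?v \<circ> Transposition.transpose i j"
  proof
    fix k
    have "?v k = x \<longleftrightarrow> k = i" "?v k = x + 1 \<longleftrightarrow> k = j"
      using ij p by (metis permutes_inj injD)+
    then show "?v k = (Transposition.transpose x (x + 1) \<circ> ?v \<circ> Transposition.transpose i j) k"
      using ij by (auto simp: Transposition.transpose_def)
  qed
  then have "adjacent_product (u @ v) = adjacent_product (u @ x # v) \<circ> Transposition.transpose i j"
    by (simp add: adjacent_product_append comp_assoc)
  ultimately show thesis using that by blast
qed

text \<open>
  The letters of \<open>w\<close>, applied from the right, must at some point reverse the relative order of the
  images of \<open>i\<close> and \<open>j\<close>; the adjacent transposition doing so is the one to delete.
\<close>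

lemma strong_exchange:
  assumes "i < j" "adjacent_product w i > adjacent_product w j"
  obtains u x v where "w = u @ x # v"
    "adjacent_product w \<circ> Transposition.transpose i j = adjacent_product (u @ v)"
  using assms
proof (induction w arbitrary: thesis)
  case (Cons x w)
  let ?w = "adjacent_product w"
  show ?case
  proof (cases "?w i > ?w j")
    case True
    obtain u y v where "w = u @ y # v" "?w \<circ> Transposition.transpose i j = adjacent_product (u @ v)"
      using Cons True by blast
    then have 1: "x # w = (x # u) @ y # v"
      and 2: "adjacent_product (x # w) \<circ> Transposition.transpose i j = adjacent_product ((x # u) @ v)"
      by (simp, simp only: adjacent_product_Cons append_Cons comp_assoc)
    show thesis by (rule Cons(2)[OF 1 2])
  next
    case False
    have inj: "?w k = ?w l \<longleftrightarrow> k = l" for k l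
      using bij_adjacent_product[of w] by (metis bij_is_inj injD)
    have "?w i < ?w j" using False inj[of i j] Cons(3) by simp
    then have ij: "?w i = x" "?w j = x + 1"
      using Cons(4) by (auto simp: Transposition.transpose_def split: if_splits)
    have "adjacent_product (x # w) \<circ> Transposition.transpose i j = ?w"
    proof
      fix k
      have "?w k = x \<longleftrightarrow> k = i" "?w k = x + 1 \<longleftrightarrow> k = j"
        using ij inj by metis+
      then show "(adjacent_product (x # w) \<circ> Transposition.transpose i j) k = ?w k"
        using ij by (auto simp: Transposition.transpose_def)
    qed
    then have "adjacent_product (x # w) \<circ> Transposition.transpose i j = adjacent_product ([] @ w)"
      by (simp only: append_Nil)
    then show thesis by (rule Cons(2)[OF append_Nil[symmetric]])
  qed
qed simp

section \<open>Inversions and Bruhat steps\<close>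

text \<open>Strong exchange turns the reversal of an inversion into the deletion of a letter from a
  reduced word. This links length, defined through words, to inversions.\<close>

lemma perm_length_inversion:
  assumes "\<pi> permutes {1..n}" "i < j" "\<pi> i > \<pi> j"
  shows "perm_length n (\<pi> \<circ> Transposition.transpose i j) < perm_length n \<pi>"
proof -
  obtain w where w: "reduced n w" "\<pi> = adjacent_product w" using ex_reduced_word assms(1) by metis
  obtain u x v where "w = u @ x # v" "\<pi> \<circ> Transposition.transpose i j = adjacent_product (u @ v)"
    using strong_exchange[of i j w] assms w by metis
  then show ?thesis
    using w perm_length_le[of "u @ v" n] by (auto simp: reduced_def)
qed

lemma transpose_comp_transpose:
  "\<pi> \<circ> Transposition.transpose i j \<circ> Transposition.transpose i j = \<pi>"
  by (simp add: comp_assoc)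

lemma bruhat_step_inversion:
  assumes "\<pi> permutes {1..n}" "i \<in> {1..n}" "j \<in> {1..n}" "i < j" "\<pi> i > \<pi> j"
  shows "bruhat_step n (\<pi> \<circ> Transposition.transpose i j) \<pi>"
  using assms perm_length_inversion[OF assms(1,4,5)]
    permutes_compose[OF permutes_swap_id[OF assms(2,3)] assms(1)]
  unfolding bruhat_step_def by (metis less_irrefl)

text \<open>Every transposition changes the length, so edges can be found without knowing their
  direction. A pair that is in order in \<open>\<pi>\<close> is an inversion of the product.\<close>

lemma bruhat_step_transpose_cases:
  assumes "\<pi> permutes {1..n}" "i \<in> {1..n}" "j \<in> {1..n}" "i \<noteq> j"
  shows "bruhat_step n (\<pi> \<circ> Transposition.transpose i j) \<pi> \<or>
         bruhat_step n \<pi> (\<pi> \<circ> Transposition.transpose i j)"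
proof -
  have *: "bruhat_step n (\<pi> \<circ> Transposition.transpose i j) \<pi> \<or>
      bruhat_step n \<pi> (\<pi> \<circ> Transposition.transpose i j)" if "i < j" "i \<in> {1..n}" "j \<in> {1..n}" for i j
  proof (cases "\<pi> i > \<pi> j")
    case True
    then show ?thesis using bruhat_step_inversion assms that by blast
  next
    case False
    let ?\<rho> = "\<pi> \<circ> Transposition.transpose i j"
    have \<rho>: "?\<rho> permutes {1..n}"
      using permutes_compose[OF permutes_swap_id[OF that(2,3)] assms(1)] .
    have "\<pi> i \<noteq> \<pi> j" using assms(1) that by (metis permutes_inj injD less_irrefl)
    then have "?\<rho> i > ?\<rho> j" using False by simp
    from bruhat_step_inversion[OF \<rho> that(2,3,1) this] show ?thesis
      unfolding transpose_comp_transpose ..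
  qed
  show ?thesis
  proof (cases "i < j")
    case True
    then show ?thesis using * assms by blast
  next
    case False
    then show ?thesis using *[of j i] assms by (simp add: transpose_commute)
  qed
qed

text \<open>
  On words with distinct letters this recovers the set of letters from the product, which shows that
  such words are reduced and that distinct subwords have distinct products.
\<close>

definition moved_cuts :: "(nat \<Rightarrow> nat) \<Rightarrow> nat set" where
  "moved_cuts \<pi> = {k. \<pi> ` {1..k} \<noteq> {1..k}}"

text \<open>Only \<open>x\<close> and \<open>x + 1\<close> move, and \<open>k = x\<close> is the
  only cut that separates them.\<close>

lemma transpose_image_Icc:
  fixes x k :: nat
  assumes "1 \<le> x" "k \<noteq> x"
  shows "Transposition.transpose x (x + 1) ` {1..k} = {1..k}"
proof (cases "x < k")
  case True
  then show ?thesis using assms permutes_image[OF permutes_swap_id[of x "{1..k}" "x + 1"]] by simp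
next
  case False
  then have "Transposition.transpose x (x + 1) i = i" if "i \<in> {1..k}" for i
    using assms that by (auto simp: Transposition.transpose_def)
  then show ?thesis by simp
qed

lemma adjacent_product_image_Icc:
  "0 \<notin> set w \<Longrightarrow> k \<notin> set w \<Longrightarrow> adjacent_product w ` {1..k} = {1..k}"
proof (induction w)
  case (Cons x w)
  have "adjacent_product (x # w) ` {1..k} = Transposition.transpose x (x + 1) ` adjacent_product w ` {1..k}"
    by (simp add: image_comp)
  then show ?case using Cons transpose_image_Icc[of x k] by simp
qed simp

text \<open>If \<open>x\<close> does not occur in \<open>w\<close>, then \<open>w\<close> preserves
  \<open>{1..x}\<close> and the new factor s_x breaks it; for \<open>k \<noteq> x\<close> the factor
  preserves \<open>{1..k}\<close> and changes nothing. The letter 0 is excluded because it exchanges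
  0 and 1 and so disturbs every \<open>{1..k}\<close> with \<open>k \<ge> 1\<close>.\<close>

lemma moved_cuts_adjacent_product:
  "distinct w \<Longrightarrow> 0 \<notin> set w \<Longrightarrow> moved_cuts (adjacent_product w) = set w"
proof (induction w)
  case Nil
  then show ?case by (simp add: moved_cuts_def)
next
  case (Cons x w)
  let ?s = "Transposition.transpose x (x + 1)" and ?w = "adjacent_product w"
  have im: "adjacent_product (x # w) ` S = ?s ` ?w ` S" for S
    by (simp add: image_comp)
  have inv: "?s ` ?s ` S = S" for S
    by (simp add: image_comp)
  have x: "1 \<le> x" using Cons by (cases x) auto
  have "k \<in> moved_cuts (adjacent_product (x # w)) \<longleftrightarrow> k = x \<or> k \<in> moved_cuts ?w" for k
  proof (cases "k = x")
    case True
    have "?w ` {1..x} = {1..x}" using Cons by (intro adjacent_product_image_Icc) auto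
    moreover have "x + 1 \<in> ?s ` {1..x}" using x by (intro image_eqI[of _ _ x]) auto
    then have "?s ` {1..x} \<noteq> {1..x}" by (metis Suc_eq_plus1 Suc_n_not_le_n atLeastAtMost_iff)
    ultimately show ?thesis unfolding moved_cuts_def im using True by simp
  next
    case False
    have "?s ` ?w ` {1..k} = {1..k} \<longleftrightarrow> ?w ` {1..k} = {1..k}"
      using inv transpose_image_Icc[OF x False] by metis
    then show ?thesis using False unfolding moved_cuts_def im by simp
  qed
  then have "moved_cuts (adjacent_product (x # w)) = insert x (moved_cuts ?w)" by blast
  then show ?case using Cons by (simp del: adjacent_product_Cons)
qed

text \<open>Every moved cut must occur as a letter in any word for the product, so no word is
  shorter than the number of moved cuts.\<close>

lemma distinct_reduced:
  assumes "distinct w" "set w \<subseteq> {1..<n}"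
  shows "reduced n w"
proof -
  obtain v where v: "reduced n v" "adjacent_product w = adjacent_product v"
    using ex_reduced_word[OF adjacent_product_permutes[OF assms(2)]] by blast
  have v0: "0 \<notin> set v" using v(1) by (auto simp: reduced_def)
  have "0 \<notin> set w" using assms(2) by auto
  then have "set w = moved_cuts (adjacent_product v)"
    using moved_cuts_adjacent_product[OF assms(1)] v(2) by simp
  also have "\<dots> \<subseteq> set v" using adjacent_product_image_Icc[OF v0] by (auto simp: moved_cuts_def)
  finally have "length w \<le> length v"
    using assms(1) by (metis List.finite_set card_length card_mono distinct_card order_trans)
  moreover have "length v \<le> length w" using reducedD[OF v(1) v(2)[symmetric] assms(2)] .
  ultimately show ?thesis using v assms(2) by (simp add: reduced_def)
qed

section \<open>Subwords and Bruhat order\<close>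

lemma bruhat_step_delete:
  assumes "reduced n (u @ x # v)"
  shows "bruhat_step n (adjacent_product (u @ v)) (adjacent_product (u @ x # v))"
proof -
  have sub: "set (u @ x # v) \<subseteq> {1..<n}" using assms by (simp add: reduced_def)
  have "\<exists>i\<in>{1..n}. \<exists>j\<in>{1..n}. i \<noteq> j \<and>
      adjacent_product (u @ v) = adjacent_product (u @ x # v) \<circ> Transposition.transpose i j"
    using adjacent_product_delete[OF sub] by metis
  moreover have "perm_length n (adjacent_product (u @ v)) < perm_length n (adjacent_product (u @ x # v))"
    using perm_length_le[of "u @ v" n] sub assms by (auto simp: reduced_def)
  ultimately show ?thesis
    using adjacent_product_permutes[OF sub] adjacent_product_permutes[of "u @ v" n] sub
    unfolding bruhat_step_def by auto
qed

text \<open>First letters are removed one at a time. What remains is a factor and hence still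
  reduced, so that every removal is a Bruhat step.\<close>

lemma bruhat_le_suffix: "reduced n (u @ v) \<Longrightarrow> bruhat_le n (adjacent_product v) (adjacent_product (u @ v))"
proof (induction u)
  case Nil
  then show ?case by (simp add: bruhat_le_def)
next
  case (Cons x u)
  have "reduced n (u @ v)" using reduced_factor[of n "[x]" "u @ v" "[]"] Cons(2) by simp
  moreover have "bruhat_step n (adjacent_product (u @ v)) (adjacent_product ((x # u) @ v))"
    using bruhat_step_delete[of n "[]" x "u @ v"] Cons(2) by (simp only: append_Nil append_Cons)
  ultimately show ?case using Cons(1) unfolding bruhat_le_def by (meson rtranclp.rtrancl_into_rtrancl)
qed

text \<open>Subwords are encoded by their letter sets. A subword of a word with distinct letters has
  distinct letters and is reduced, so adding a letter goes up.\<close>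

lemma bruhat_step_filter_insert:
  assumes "distinct w" "set w \<subseteq> {1..<n}" "x \<in> set w" "x \<notin> A"
  obtains i j where "i \<in> {1..n}" "j \<in> {1..n}" "i \<noteq> j"
    "adjacent_product (filter (\<lambda>y. y \<in> A) w) =
       adjacent_product (filter (\<lambda>y. y \<in> insert x A) w) \<circ> Transposition.transpose i j"
    "bruhat_step n (adjacent_product (filter (\<lambda>y. y \<in> A) w)) (adjacent_product (filter (\<lambda>y. y \<in> insert x A) w))"
proof -
  obtain p q where w: "w = p @ x # q" using assms(3) by (meson split_list)
  have pq: "x \<notin> set p" "x \<notin> set q" using assms(1) w by auto
  have eq: "filter (\<lambda>y. y \<in> insert x A) p = filter (\<lambda>y. y \<in> A) p"
    "filter (\<lambda>y. y \<in> insert x A) q = filter (\<lambda>y. y \<in> A) q"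
    using pq by (auto intro!: filter_cong)
  let ?p = "filter (\<lambda>y. y \<in> A) p" and ?q = "filter (\<lambda>y. y \<in> A) q"
  have 1: "filter (\<lambda>y. y \<in> A) w = ?p @ ?q" using w assms(4) by simp
  have 2: "filter (\<lambda>y. y \<in> insert x A) w = ?p @ x # ?q" unfolding w filter_append using eq by simp
  have "distinct (?p @ x # ?q)" "set (?p @ x # ?q) \<subseteq> {1..<n}" using assms w by auto
  then have red: "reduced n (?p @ x # ?q)" by (rule distinct_reduced)
  obtain i j where "i \<in> {1..n}" "j \<in> {1..n}" "i \<noteq> j"
    "adjacent_product (?p @ ?q) = adjacent_product (?p @ x # ?q) \<circ> Transposition.transpose i j"
    using adjacent_product_delete \<open>set (?p @ x # ?q) \<subseteq> {1..<n}\<close> by blast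
  then show thesis using that bruhat_step_delete[OF red] unfolding 1 2 by blast
qed

text \<open>Whatever transposition is used, strong exchange makes a step down the deletion of one
  letter; hence only cube edges occur below \<open>w\<close>.\<close>

lemma bruhat_step_below_distinct:
  assumes "distinct w" "set w \<subseteq> {1..<n}" "A \<subseteq> set w"
    and step: "bruhat_step n \<pi> (adjacent_product (filter (\<lambda>y. y \<in> A) w))"
  shows "\<exists>x\<in>A. \<pi> = adjacent_product (filter (\<lambda>y. y \<in> A - {x}) w)"
proof -
  let ?f = "filter (\<lambda>y. y \<in> A) w" and ?\<tau> = "adjacent_product (filter (\<lambda>y. y \<in> A) w)"
  have "\<exists>i j. i \<in> {1..n} \<and> j \<in> {1..n} \<and> i < j \<and> \<pi> = ?\<tau> \<circ> Transposition.transpose i j"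
  proof -
    obtain i j where ij: "i \<in> {1..n}" "j \<in> {1..n}" "i \<noteq> j" "\<pi> = ?\<tau> \<circ> Transposition.transpose i j"
      using step unfolding bruhat_step_def by blast
    then have "\<pi> = ?\<tau> \<circ> Transposition.transpose j i" by (simp only: transpose_commute)
    then show ?thesis using ij by (metis nat_neq_iff)
  qed
  then obtain i j where ij: "i \<in> {1..n}" "j \<in> {1..n}" "i < j" "\<pi> = ?\<tau> \<circ> Transposition.transpose i j"
    by blast
  \<comment> \<open>Otherwise \<open>\<pi>\<close> would have the inversion and the step would lead
    down from it.\<close>
  have "?\<tau> i > ?\<tau> j"
  proof (rule ccontr)
    assume "\<not> ?\<tau> i > ?\<tau> j"
    moreover have "?\<tau> i \<noteq> ?\<tau> j"
      using ij(3) bij_adjacent_product[of ?f] by (metis bij_is_inj injD less_irrefl)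
    ultimately have "\<pi> i > \<pi> j" using ij(4) by simp
    moreover have "\<pi> permutes {1..n}" using step by (simp add: bruhat_step_def)
    ultimately have "perm_length n (\<pi> \<circ> Transposition.transpose i j) < perm_length n \<pi>"
      using perm_length_inversion ij(3) by blast
    then show False using step unfolding ij(4) transpose_comp_transpose bruhat_step_def by simp
  qed
  then obtain p x q where pq: "?f = p @ x # q" "\<pi> = adjacent_product (p @ q)"
    using strong_exchange[OF ij(3)] ij(4) by metis
  have d: "distinct (p @ x # q)" using assms(1) pq(1) by (metis distinct_filter)
  have "x \<in> set ?f" unfolding pq(1) by simp
  then have "x \<in> A" by simp
  \<comment> \<open>As the letters are distinct, deleting one occurrence of \<open>x\<close> is
    removing \<open>x\<close> from the letter set.\<close>
  have "filter (\<lambda>y. y \<in> A - {x}) w = filter (\<lambda>y. y \<noteq> x) ?f"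
    by (simp add: conj_commute)
  also have "filter (\<lambda>y. y \<noteq> x) p = p" "filter (\<lambda>y. y \<noteq> x) q = q"
    using d by (auto intro!: filter_True)
  then have "filter (\<lambda>y. y \<noteq> x) ?f = p @ q" unfolding pq(1) by simp
  finally show ?thesis using \<open>x \<in> A\<close> pq(2) by metis
qed

lemma bruhat_le_distinct:
  assumes "distinct w" "set w \<subseteq> {1..<n}" "bruhat_le n \<pi> (adjacent_product w)"
  shows "\<exists>A\<subseteq>set w. \<pi> = adjacent_product (filter (\<lambda>y. y \<in> A) w)"
  using assms(3) unfolding bruhat_le_def
proof (induction rule: converse_rtranclp_induct)
  case base
  have "filter (\<lambda>y. y \<in> set w) w = w" by simp
  then show ?case by (metis order_refl)
next
  case (step \<pi> \<rho>)
  then obtain A where A: "A \<subseteq> set w" "\<rho> = adjacent_product (filter (\<lambda>y. y \<in> A) w)" by blast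
  then obtain x where "\<pi> = adjacent_product (filter (\<lambda>y. y \<in> A - {x}) w)"
    using bruhat_step_below_distinct[OF assms(1,2) A(1)] step(1) by blast
  then show ?case using A(1) by (intro exI[of _ "A - {x}"]) auto
qed

lemma bruhat_le_filter:
  assumes "distinct w" "set w \<subseteq> {1..<n}" "A \<subseteq> set w"
  shows "bruhat_le n (adjacent_product (filter (\<lambda>y. y \<in> A) w)) (adjacent_product w)"
proof -
  \<comment> \<open>Induction on the set of deleted letters, starting from \<open>w\<close>
    itself.\<close>
  have "bruhat_le n (adjacent_product (filter (\<lambda>y. y \<in> set w - D) w)) (adjacent_product w)"
    if "finite D" "D \<subseteq> set w" for D
    using that
  proof (induction D rule: finite_induct)
    case empty
    have "filter (\<lambda>y. y \<in> set w - {}) w = w" by simp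
    then show ?case by (simp add: bruhat_le_def)
  next
    case (insert x D)
    have "insert x (set w - insert x D) = set w - D" using insert by auto
    then have "bruhat_step n (adjacent_product (filter (\<lambda>y. y \<in> set w - insert x D) w))
        (adjacent_product (filter (\<lambda>y. y \<in> set w - D) w))"
      using bruhat_step_filter_insert[OF assms(1,2), of x "set w - insert x D"] insert by (metis DiffE insertI1 insert_subset)
    then show ?case using insert unfolding bruhat_le_def by (meson converse_rtranclp_into_rtranclp insert_subset)
  qed
  from this[of "set w - A"] show ?thesis using assms(3) by (simp add: double_diff)
qed

text \<open>\<open>moved_cuts\<close> is an explicit inverse of the map from letter sets to
  products. The map embeds a cube into the graph, its inverse embeds the graph into a cube.\<close>

lemma moved_cuts_filter:
  assumes "distinct w" "set w \<subseteq> {1..<n}" "A \<subseteq> set w"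
  shows "moved_cuts (adjacent_product (filter (\<lambda>y. y \<in> A) w)) = A"
proof -
  have "moved_cuts (adjacent_product (filter (\<lambda>y. y \<in> A) w)) = set (filter (\<lambda>y. y \<in> A) w)"
    using assms by (intro moved_cuts_adjacent_product) auto
  then show ?thesis using assms(3) by auto
qed

section \<open>Planarity of Bruhat graphs\<close>

lemma contains_321_iff:
  "contains_pattern n \<tau> 3 (one_line [3, 2, 1]) \<longleftrightarrow>
     (\<exists>i j k. i \<in> {1..n} \<and> j \<in> {1..n} \<and> k \<in> {1..n} \<and> i < j \<and> j < k \<and> \<tau> i > \<tau> j \<and> \<tau> j > \<tau> k)"
proof
  have vals: "one_line [3, 2, 1] 1 = 3" "one_line [3, 2, 1] 2 = 2" "one_line [3, 2, 1] 3 = 1"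
    by (simp_all add: one_line_def)
  have three: "{1..3} = {1, 2, 3::nat}" by auto
  {
    assume "contains_pattern n \<tau> 3 (one_line [3, 2, 1])"
    then obtain idx where idx: "strict_mono_on {1..3} idx" "idx ` {1..3} \<subseteq> {1..n}"
      "\<forall>a\<in>{1..3}. \<forall>b\<in>{1..3}. \<tau> (idx a) < \<tau> (idx b) \<longleftrightarrow> one_line [3, 2, 1] a < one_line [3, 2, 1] b"
      unfolding contains_pattern_def by blast
    have "idx 1 < idx 2" "idx 2 < idx 3"
      using strict_mono_onD[OF idx(1)] by auto
    moreover have "\<tau> (idx 2) < \<tau> (idx 1)" "\<tau> (idx 3) < \<tau> (idx 2)"
      using idx(3) vals by auto
    moreover have "idx 1 \<in> {1..n}" "idx 2 \<in> {1..n}" "idx 3 \<in> {1..n}"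
      using idx(2) by (auto simp: image_subset_iff)
    ultimately show "\<exists>i j k. i \<in> {1..n} \<and> j \<in> {1..n} \<and> k \<in> {1..n} \<and> i < j \<and> j < k \<and> \<tau> i > \<tau> j \<and> \<tau> j > \<tau> k"
      by blast
  }
  assume "\<exists>i j k. i \<in> {1..n} \<and> j \<in> {1..n} \<and> k \<in> {1..n} \<and> i < j \<and> j < k \<and> \<tau> i > \<tau> j \<and> \<tau> j > \<tau> k"
  then obtain i j k where ijk: "i \<in> {1..n}" "j \<in> {1..n}" "k \<in> {1..n}" "i < j" "j < k" "\<tau> i > \<tau> j" "\<tau> j > \<tau> k"
    by blast
  define idx :: "nat \<Rightarrow> nat" where "idx a = (if a = 1 then i else if a = 2 then j else k)" for a
  show "contains_pattern n \<tau> 3 (one_line [3, 2, 1])"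
    unfolding contains_pattern_def three
    using ijk by (intro exI[of _ idx]) (auto simp: idx_def strict_mono_on_def vals[unfolded One_nat_def])
qed

definition bruhat_interval :: "nat \<Rightarrow> (nat \<Rightarrow> nat) \<Rightarrow> (nat \<Rightarrow> nat) set" where
  "bruhat_interval n \<sigma> = {\<tau>. \<tau> permutes {1..n} \<and> bruhat_le n \<tau> \<sigma>}"

lemma verts_bruhat_graph: "verts (bruhat_graph n \<sigma>) = bruhat_interval n \<sigma>"
  by (simp add: bruhat_graph_def bruhat_interval_def)

lemma undirected_edges_bruhat_graph:
  "undirected_edges (bruhat_graph n \<sigma>) =
     {{\<tau>, \<rho>} |\<tau> \<rho>. \<tau> \<in> bruhat_interval n \<sigma> \<and> \<rho> \<in> bruhat_interval n \<sigma> \<and> bruhat_step n \<tau> \<rho>}"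
  by (auto simp: undirected_edges_def bruhat_graph_def induce_subgraph_def full_bruhat_graph_def
      bruhat_interval_def image_def)

lemma bruhat_interval_step:
  "\<tau> \<in> bruhat_interval n \<sigma> \<Longrightarrow> bruhat_step n \<rho> \<tau> \<Longrightarrow> \<rho> \<in> bruhat_interval n \<sigma>"
  unfolding bruhat_interval_def bruhat_le_def mem_Collect_eq
  by (metis bruhat_step_def converse_rtranclp_into_rtranclp)

lemma bruhat_graph_edgeI:
  assumes "\<tau> \<in> bruhat_interval n \<sigma>" "\<tau> \<circ> Transposition.transpose i j \<in> bruhat_interval n \<sigma>"
    "i \<in> {1..n}" "j \<in> {1..n}" "i \<noteq> j"
  shows "{\<tau>, \<tau> \<circ> Transposition.transpose i j} \<in> undirected_edges (bruhat_graph n \<sigma>)"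
proof -
  have "\<tau> permutes {1..n}" using assms(1) by (simp add: bruhat_interval_def)
  from bruhat_step_transpose_cases[OF this assms(3-5)] show ?thesis
    unfolding undirected_edges_bruhat_graph using assms(1,2) by (blast intro: insert_commute)
qed

text \<open>
  The coset of \<open>\<tau>\<close> under the permutations of the positions \<open>i\<close>, \<open>j\<close>, \<open>k\<close> lies below \<open>\<tau>\<close>, and in
  the symmetric group of order six every even and odd element differ by a transposition.
\<close>

lemma nonplanar_above_321:
  assumes V: "\<tau> \<in> bruhat_interval n \<sigma>"
    and ijk: "i \<in> {1..n}" "j \<in> {1..n}" "k \<in> {1..n}" "i < j" "j < k" "\<tau> i > \<tau> j" "\<tau> j > \<tau> k"
  shows "\<not> planar (bruhat_graph n \<sigma>)"
proof
  assume "planar (bruhat_graph n \<sigma>)"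
  then obtain pos curve where draw:
    "plane_drawing (bruhat_interval n \<sigma>) (undirected_edges (bruhat_graph n \<sigma>)) pos curve"
    unfolding planar_def verts_bruhat_graph by blast
  define r s t where "r = Transposition.transpose i j" and "s = Transposition.transpose j k"
    and "t = Transposition.transpose i k"
  note rst = r_def s_def t_def
  have ik: "i < k" "\<tau> i > \<tau> k" "i \<noteq> j" "j \<noteq> k" "i \<noteq> k" using ijk by auto
  have down: "\<rho> \<circ> Transposition.transpose a b \<in> bruhat_interval n \<sigma>"
    if "\<rho> \<in> bruhat_interval n \<sigma>" "a \<in> {1..n}" "b \<in> {1..n}" "a < b" "\<rho> a > \<rho> b" for \<rho> a b
    using bruhat_interval_step[OF that(1) bruhat_step_inversion] that by (simp add: bruhat_interval_def)
  \<comment> \<open>Write 321 for \<open>\<tau>\<close> on the positions \<open>i\<close>,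
    \<open>j\<close>, \<open>k\<close>. Then \<open>r\<close>, \<open>s\<close>, \<open>t\<close>
    lead to 231, 312, 123, while \<open>r \<circ> s\<close> and \<open>s \<circ> r\<close> lead to
    213 and 132; all are reached by reversing inversions.\<close>
  have in_V: "\<tau> \<circ> r \<in> bruhat_interval n \<sigma>" "\<tau> \<circ> s \<in> bruhat_interval n \<sigma>" "\<tau> \<circ> t \<in> bruhat_interval n \<sigma>"
    unfolding rst using down[OF V] ijk ik by blast+
  have rs: "\<tau> \<circ> r \<circ> s \<in> bruhat_interval n \<sigma>"
    unfolding s_def using in_V(1) ijk ik by (intro down) (simp_all add: r_def)
  have sr: "\<tau> \<circ> s \<circ> r \<in> bruhat_interval n \<sigma>"
    unfolding r_def using in_V(2) ijk ik by (intro down) (simp_all add: s_def)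
  let ?xs = "[\<tau>, \<tau> \<circ> r \<circ> s, \<tau> \<circ> s \<circ> r]" and ?ys = "[\<tau> \<circ> r, \<tau> \<circ> s, \<tau> \<circ> t]"
  show False
  proof (rule no_plane_K33[OF draw, of ?xs ?ys])
    have "distinct (map (\<lambda>\<rho>. (\<rho> i, \<rho> j, \<rho> k)) (?xs @ ?ys))"
      using ijk ik by (simp add: rst)
    then show "distinct (?xs @ ?ys)" unfolding distinct_map by blast
    show "set ?xs \<union> set ?ys \<subseteq> bruhat_interval n \<sigma>"
      using V in_V rs sr by simp
    have edge: "{\<rho>, \<rho>'} \<in> undirected_edges (bruhat_graph n \<sigma>)"
      if "\<rho> \<in> bruhat_interval n \<sigma>" "\<rho>' \<in> bruhat_interval n \<sigma>"
        "\<rho>' = \<rho> \<circ> r \<or> \<rho>' = \<rho> \<circ> s \<or> \<rho>' = \<rho> \<circ> t" for \<rho> \<rho>'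
      using that(3) that(1,2) ijk(1-3) ik unfolding rst by (blast intro: bruhat_graph_edgeI)
    have rel: "r \<circ> s \<circ> s = r" "r \<circ> s \<circ> t = s" "r \<circ> s \<circ> r = t"
      "s \<circ> r \<circ> r = s" "s \<circ> r \<circ> t = r" "s \<circ> r \<circ> s = t"
      using ik by (auto simp: fun_eq_iff rst Transposition.transpose_def)
    have rel': "\<tau> \<circ> r \<circ> s \<circ> s = \<tau> \<circ> r" "\<tau> \<circ> r \<circ> s \<circ> t = \<tau> \<circ> s" "\<tau> \<circ> r \<circ> s \<circ> r = \<tau> \<circ> t"
      "\<tau> \<circ> s \<circ> r \<circ> r = \<tau> \<circ> s" "\<tau> \<circ> s \<circ> r \<circ> t = \<tau> \<circ> r" "\<tau> \<circ> s \<circ> r \<circ> s = \<tau> \<circ> t"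
      using rel by (metis comp_assoc)+
    fix x y assume "x \<in> set ?xs" "y \<in> set ?ys"
    moreover from this have "x \<in> bruhat_interval n \<sigma>" "y \<in> bruhat_interval n \<sigma>"
      using V in_V rs sr by auto
    moreover from calculation(1,2) have "y = x \<circ> r \<or> y = x \<circ> s \<or> y = x \<circ> t"
      using rel' by (simp only: set_simps insert_iff empty_iff) metis
    ultimately show "{x, y} \<in> undirected_edges (bruhat_graph n \<sigma>)" by (intro edge)
  qed simp_all
qed

section \<open>Words with distinct letters\<close>

text \<open>Relabels the coordinates of a cube; an injection into a larger set selects a
  subcube.\<close>

lemma plane_drawing_cube_transfer:
  assumes "plane_drawing (Pow T) (cube_edges T) pos curve" "inj_on h S" "h ` S \<subseteq> T"
  shows "plane_drawing (Pow S) (cube_edges S) (pos \<circ> (`) h) (\<lambda>e. curve ((`) h ` e))"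
proof (rule plane_drawing_subgraph[OF assms(1)])
  show "inj_on ((`) h) (Pow S)" using assms(2) by (rule inj_on_image_Pow)
  show "(`) h ` Pow S \<subseteq> Pow T" using assms(3) by blast
  fix e assume "e \<in> cube_edges S"
  then obtain A x where e: "e = {A, insert x A}" "A \<subseteq> S" "x \<in> S - A" by (auto simp: cube_edges_def)
  then have "h x \<notin> h ` A" using assms(2) by (auto dest: inj_onD)
  then have "(`) h ` e = {h ` A, insert (h x) (h ` A)} \<and> h ` A \<subseteq> T \<and> h x \<in> T - h ` A"
    using e assms(3) by auto
  then show "e \<subseteq> Pow S \<and> (`) h ` e \<in> cube_edges T"
    using e unfolding cube_edges_def by blast
qed

lemma nonplanar_above_boolean4:
  assumes "distinct w" "length w = 4" "set w \<subseteq> {1..<n}" "adjacent_product w \<in> bruhat_interval n \<sigma>"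
  shows "\<not> planar (bruhat_graph n \<sigma>)"
proof
  assume "planar (bruhat_graph n \<sigma>)"
  then obtain pos curve where draw:
    "plane_drawing (bruhat_interval n \<sigma>) (undirected_edges (bruhat_graph n \<sigma>)) pos curve"
    unfolding planar_def verts_bruhat_graph by blast
  define f where "f A = adjacent_product (filter (\<lambda>y. y \<in> A) w)" for A
  have f_in: "f A \<in> bruhat_interval n \<sigma>" if "A \<subseteq> set w" for A
  proof -
    have "bruhat_le n (f A) (adjacent_product w)"
      unfolding f_def using bruhat_le_filter assms(1,3) that by blast
    moreover have "bruhat_le n (adjacent_product w) \<sigma>" using assms(4) by (simp add: bruhat_interval_def)
    moreover have "f A permutes {1..n}"
      unfolding f_def using assms(3) by (intro adjacent_product_permutes) auto
    ultimately show ?thesis unfolding bruhat_interval_def bruhat_le_def by auto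
  qed
  have "plane_drawing (Pow (set w)) (cube_edges (set w)) (pos \<circ> f) (\<lambda>e. curve (f ` e))"
  proof (rule plane_drawing_subgraph[OF draw])
    show "inj_on f (Pow (set w))"
      using moved_cuts_filter[OF assms(1,3)] unfolding f_def by (intro inj_on_inverseI[of _ moved_cuts]) auto
    show "f ` Pow (set w) \<subseteq> bruhat_interval n \<sigma>" using f_in by blast
    fix e assume "e \<in> cube_edges (set w)"
    then obtain A x where e: "e = {A, insert x A}" "A \<subseteq> set w" "x \<in> set w" "x \<notin> A"
      by (auto simp: cube_edges_def)
    have "bruhat_step n (f A) (f (insert x A))"
      using bruhat_step_filter_insert[OF assms(1,3) e(3,4)] unfolding f_def by blast
    then show "e \<subseteq> Pow (set w) \<and> f ` e \<in> undirected_edges (bruhat_graph n \<sigma>)"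
      using e f_in[of A] f_in[of "insert x A"] unfolding undirected_edges_bruhat_graph by auto
  qed
  moreover have "inj_on ((!) w) {0, 1, 2, 3}" "(!) w ` {0, 1, 2, 3} \<subseteq> set w"
    using assms(1,2) by (auto simp: inj_on_def nth_eq_iff_index_eq)
  ultimately have "plane_drawing (Pow {0, 1, 2, 3}) (cube_edges {0, 1, 2, 3}) (pos \<circ> f \<circ> (`) ((!) w))
      (\<lambda>e. curve (f ` ((`) ((!) w) ` e)))"
    by (rule plane_drawing_cube_transfer)
  with no_plane_cube4 show False by (rule notE)
qed

text \<open>Here the embedding goes the opposite way from the case of four letters:
  \<open>moved_cuts\<close> sends the whole graph into the cube on the letters, which
  \<open>h\<close> places in the 3-cube.\<close>

lemma planar_below_boolean3:
  assumes "distinct w" "length w \<le> 3" "set w \<subseteq> {1..<n}"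
  shows "planar (bruhat_graph n (adjacent_product w))"
proof -
  let ?\<sigma> = "adjacent_product w"
  obtain h where h: "h ` set w \<subseteq> {0, 1, 2::nat}" "inj_on h (set w)"
    using card_le_inj[of "set w" "{0, 1, 2::nat}"] assms(1,2) by (auto simp: distinct_card)
  obtain curve where draw: "plane_drawing (Pow (set w)) (cube_edges (set w)) (cube3_pos \<circ> (`) h) curve"
    using ex_plane_drawing_cube3 plane_drawing_cube_transfer[OF _ h(2,1)] by blast
  have V: "\<exists>A\<subseteq>set w. \<tau> = adjacent_product (filter (\<lambda>y. y \<in> A) w)" if "\<tau> \<in> bruhat_interval n ?\<sigma>" for \<tau>
    using bruhat_le_distinct[OF assms(1,3)] that by (simp add: bruhat_interval_def)
  note cuts = moved_cuts_filter[OF assms(1,3)]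
  have "plane_drawing (bruhat_interval n ?\<sigma>) (undirected_edges (bruhat_graph n ?\<sigma>))
      (cube3_pos \<circ> (`) h \<circ> moved_cuts) (\<lambda>e. curve (moved_cuts ` e))"
  proof (rule plane_drawing_subgraph[OF draw])
    show "inj_on moved_cuts (bruhat_interval n ?\<sigma>)"
      by (rule inj_onI) (metis V cuts)
    show "moved_cuts ` bruhat_interval n ?\<sigma> \<subseteq> Pow (set w)"
      using V cuts by fastforce
    fix e assume "e \<in> undirected_edges (bruhat_graph n ?\<sigma>)"
    then obtain \<tau> \<rho> where e: "e = {\<tau>, \<rho>}" "\<tau> \<in> bruhat_interval n ?\<sigma>" "\<rho> \<in> bruhat_interval n ?\<sigma>"
      "bruhat_step n \<tau> \<rho>"
      unfolding undirected_edges_bruhat_graph by blast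
    obtain A where A: "A \<subseteq> set w" "\<rho> = adjacent_product (filter (\<lambda>y. y \<in> A) w)" using V[OF e(3)] by blast
    then obtain x where x: "x \<in> A" "\<tau> = adjacent_product (filter (\<lambda>y. y \<in> A - {x}) w)"
      using bruhat_step_below_distinct[OF assms(1,3) A(1)] e(4) by blast
    have "moved_cuts \<rho> = A" unfolding A(2) using cuts A(1) by blast
    moreover have "moved_cuts \<tau> = A - {x}" unfolding x(2) using cuts[of "A - {x}"] A(1) by blast
    ultimately have "moved_cuts ` e = {A - {x}, insert x (A - {x})}" using e(1) x(1) by auto
    then have "moved_cuts ` e \<in> cube_edges (set w)"
      using A(1) x(1) unfolding cube_edges_def by blast
    then show "e \<subseteq> bruhat_interval n ?\<sigma> \<and> moved_cuts ` e \<in> cube_edges (set w)"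
      using e by auto
  qed
  then show ?thesis unfolding planar_def verts_bruhat_graph by blast
qed

section \<open>Repeated letters in short reduced words\<close>

lemma adjacent_product_repeat: "adjacent_product (u @ a # a # v) = adjacent_product (u @ v)"
proof -
  have "Transposition.transpose a (a + 1) \<circ> (Transposition.transpose a (a + 1) \<circ> f) = f" for f :: "nat \<Rightarrow> nat"
    by (simp add: fun_eq_iff)
  then show ?thesis by (simp only: adjacent_product_append adjacent_product_Cons)
qed

lemma adjacent_product_swap:
  assumes "b \<noteq> a + 1" "a \<noteq> b + 1"
  shows "adjacent_product (u @ a # b # v) = adjacent_product (u @ b # a # v)"
proof -
  have "Transposition.transpose a (a + 1) \<circ> (Transposition.transpose b (b + 1) \<circ> f) =
      Transposition.transpose b (b + 1) \<circ> (Transposition.transpose a (a + 1) \<circ> f)" for f :: "nat \<Rightarrow> nat"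
    using assms by (auto simp: fun_eq_iff Transposition.transpose_def)
  then show ?thesis by (simp only: adjacent_product_append adjacent_product_Cons)
qed

lemma not_reduced_repeat: "\<not> reduced n (u @ a # a # v)"
proof
  assume "reduced n (u @ a # a # v)"
  then show False
    using reducedD[of n "u @ a # a # v" "u @ v"] by (simp add: adjacent_product_repeat reduced_def)
qed

text \<open>If the two transpositions commuted, the word would collapse to
  \<open>[b]\<close>.\<close>

lemma reduced_sandwich:
  assumes "reduced n [a, b, a]" shows "b = a + 1 \<or> a = b + 1"
proof (rule ccontr)
  assume "\<not> (b = a + 1 \<or> a = b + 1)"
  then have n: "b \<noteq> a + 1" "a \<noteq> b + 1" by auto
  have "adjacent_product [a, b, a] = adjacent_product [b]"
    using adjacent_product_swap[OF n, of "[]" "[a]"] adjacent_product_repeat[of "[b]" a "[]"]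
    by (simp only: append_Nil append_Cons)
  then show False using reducedD[OF assms, of "[b]"] assms by (simp add: reduced_def)
qed

text \<open>For neighbouring letters the product is the transposition of \<open>m\<close> and
  \<open>m + 2\<close>.\<close>

lemma braid_321:
  assumes "b = a + 1 \<or> a = b + 1" "{a, b} \<subseteq> {1..<n}"
  defines "\<pi> \<equiv> adjacent_product [a, b, a]"
  shows "\<exists>i j k. i \<in> {1..n} \<and> j \<in> {1..n} \<and> k \<in> {1..n} \<and> i < j \<and> j < k \<and> \<pi> i > \<pi> j \<and> \<pi> j > \<pi> k"
proof -
  define m where "m = min a b"
  have m: "1 \<le> m" "m + 2 \<le> n" using assms(1,2) by (auto simp: m_def)
  have "\<pi> m = m + 2 \<and> \<pi> (m + 1) = m + 1 \<and> \<pi> (m + 2) = m"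
    using assms(1)
  proof
    assume b: "b = a + 1"
    then have "m = a" by (simp add: m_def)
    then show ?thesis using b by (simp add: \<pi>_def Transposition.transpose_def)
  next
    assume a: "a = b + 1"
    then have "m = b" by (simp add: m_def)
    then show ?thesis using a by (simp add: \<pi>_def Transposition.transpose_def)
  qed
  then show ?thesis
    using m by (intro exI[of _ m] exI[of _ "m + 1"] exI[of _ "m + 2"]) simp
qed

lemma nonplanar_above_braid:
  assumes "b = a + 1 \<or> a = b + 1" "{a, b} \<subseteq> {1..<n}" "adjacent_product [a, b, a] \<in> bruhat_interval n \<sigma>"
  shows "\<not> planar (bruhat_graph n \<sigma>)"
  using braid_321[OF assms(1,2)] by (elim exE conjE) (rule nonplanar_above_321[OF assms(3)])

lemma nonplanar_length_4:
  assumes red: "reduced n [a, b, c, d]" and V: "adjacent_product [a, b, c, d] \<in> bruhat_interval n \<sigma>"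
  shows "\<not> planar (bruhat_graph n \<sigma>)"
proof (cases "distinct [a, b, c, d]")
  case True
  then show ?thesis using nonplanar_above_boolean4[OF True _ _ V] red by (simp add: reduced_def)
next
  case False
  have sub: "{a, b, c, d} \<subseteq> {1..<n}" using red by (simp add: reduced_def)
  have "a \<noteq> b" "b \<noteq> c" "c \<noteq> d"
    using not_reduced_repeat[of n "[]" a "[c, d]"] not_reduced_repeat[of n "[a]" b "[d]"]
      not_reduced_repeat[of n "[a, b]" c "[]"] red by auto
  \<comment> \<open>Equal neighbours are excluded, so a repetition is at distance two or at the two
    ends.\<close>
  with False consider "a = c" | "b = d" | "a = d" "b \<noteq> a" "c \<noteq> a" "b \<noteq> c" by auto
  then show ?thesis
  proof cases
    case 1
    have red': "reduced n [a, b, a]" using reduced_factor[of n "[]" "[a, b, a]" "[d]"] red 1 by simp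
    have "adjacent_product [a, b, a] \<in> bruhat_interval n \<sigma>"
      using bruhat_interval_step[OF V] bruhat_step_delete[of n "[a, b, c]" d "[]"] red 1
      by (simp only: append_Nil append_Cons)
    then show ?thesis using sub by (intro nonplanar_above_braid[OF reduced_sandwich[OF red']]) auto
  next
    case 2
    have red': "reduced n [b, c, b]" using reduced_factor[of n "[a]" "[b, c, b]" "[]"] red 2 by simp
    have "adjacent_product [b, c, b] \<in> bruhat_interval n \<sigma>"
      using bruhat_interval_step[OF V] bruhat_step_delete[of n "[]" a "[b, c, d]"] red 2
      by (simp only: append_Nil append_Cons)
    then show ?thesis using sub by (intro nonplanar_above_braid[OF reduced_sandwich[OF red']]) auto
  next
    case 3
    \<comment> \<open>Deleting an inner letter of the reduced word goes down whether or not the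
      three-letter word is reduced.\<close>
    have b: "adjacent_product [a, b, a] \<in> bruhat_interval n \<sigma>"
      using bruhat_interval_step[OF V] bruhat_step_delete[of n "[a, b]" c "[d]"] red 3
      by (simp only: append_Nil append_Cons)
    have c: "adjacent_product [a, c, a] \<in> bruhat_interval n \<sigma>"
      using bruhat_interval_step[OF V] bruhat_step_delete[of n "[a]" b "[c, d]"] red 3
      by (simp only: append_Nil append_Cons)
    \<comment> \<open>If \<open>a\<close> commuted with both inner letters, the outer letters would
      cancel and leave \<open>[b, c]\<close>.\<close>
    have "(b = a + 1 \<or> a = b + 1) \<or> (c = a + 1 \<or> a = c + 1)"
    proof (rule ccontr)
      assume "\<not> ?thesis"
      then have n: "b \<noteq> a + 1" "a \<noteq> b + 1" "c \<noteq> a + 1" "a \<noteq> c + 1" by auto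
      have "adjacent_product [a, b, c, d] = adjacent_product [b, c]"
        using adjacent_product_swap[OF n(1,2), of "[]" "[c, a]"] adjacent_product_swap[OF n(3,4), of "[b]" "[a]"]
          adjacent_product_repeat[of "[b, c]" a "[]"] 3(1)
        by (simp only: append_Nil append_Cons)
      then show False using reducedD[OF red, of "[b, c]"] sub by simp
    qed
    then show ?thesis using nonplanar_above_braid[OF _ _ b] nonplanar_above_braid[OF _ _ c] sub by auto
  qed
qed

theorem theorem3p1:
  fixes n :: nat and \<sigma> :: "nat \<Rightarrow> nat"
  assumes "n \<ge> 1" and "\<sigma> permutes {1..n}"
  shows "planar (bruhat_graph n \<sigma>) \<longleftrightarrow>
           avoids_pattern n \<sigma> 3 (one_line [3, 2, 1]) \<and> perm_length n \<sigma> \<le> 3"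
proof -
  obtain w where w: "reduced n w" "\<sigma> = adjacent_product w" using ex_reduced_word[OF assms(2)] by blast
  have len: "perm_length n \<sigma> = length w" and sub: "set w \<subseteq> {1..<n}" using w by (auto simp: reduced_def)
  have top: "\<sigma> \<in> bruhat_interval n \<sigma>" using assms(2) by (simp add: bruhat_interval_def bruhat_le_def)
  show ?thesis
  proof
    assume planar: "planar (bruhat_graph n \<sigma>)"
    have "avoids_pattern n \<sigma> 3 (one_line [3, 2, 1])"
      unfolding avoids_pattern_def contains_321_iff using nonplanar_above_321[OF top] planar by blast
    moreover have "length w \<le> 3"
    proof (rule ccontr)
      assume "\<not> length w \<le> 3"
      define u v where "u = take (length w - 4) w" and "v = drop (length w - 4) w"
      have uv: "w = u @ v" by (simp add: u_def v_def)
      have "length v = 4" using \<open>\<not> length w \<le> 3\<close> by (simp add: v_def)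
      then obtain a b c d where v: "v = [a, b, c, d]"
        by (auto simp: numeral_eq_Suc length_Suc_conv)
      have "reduced n v" using reduced_factor[of n u v "[]"] w(1) uv by simp
      moreover have "bruhat_le n (adjacent_product v) \<sigma>"
        using bruhat_le_suffix[of n u v] w uv by simp
      moreover have "adjacent_product v permutes {1..n}"
        using sub uv by (intro adjacent_product_permutes) auto
      ultimately show False
        using nonplanar_length_4 planar unfolding v bruhat_interval_def by blast
    qed
    ultimately show "avoids_pattern n \<sigma> 3 (one_line [3, 2, 1]) \<and> perm_length n \<sigma> \<le> 3"
      using len by simp
  next
    assume "avoids_pattern n \<sigma> 3 (one_line [3, 2, 1]) \<and> perm_length n \<sigma> \<le> 3"
    then have avoid: "\<not> contains_pattern n \<sigma> 3 (one_line [3, 2, 1])" and len3: "length w \<le> 3"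
      using len by (auto simp: avoids_pattern_def)
    have "distinct w"
    proof -
      consider "w = []" | a where "w = [a]" | a b where "w = [a, b]" | a b c where "w = [a, b, c]"
        using len3 by (cases w rule: remdups_adj.cases; cases "tl (tl w)") (auto simp: length_Suc_conv)
      then show ?thesis
      proof cases
        case 3
        then show ?thesis using not_reduced_repeat[of n "[]" a "[]"] w(1) by auto
      next
        case 4
        have "a \<noteq> b" "b \<noteq> c"
          using not_reduced_repeat[of n "[]" a "[c]"] not_reduced_repeat[of n "[a]" b "[]"] w(1) 4 by auto
        moreover have "a \<noteq> c"
        \<comment> \<open>The only repetition left would make \<open>\<sigma>\<close> a braid word,
          which contains 321.\<close>
        proof
          assume "a = c"
          then have aba: "reduced n [a, b, a]" "\<sigma> = adjacent_product [a, b, a]" using w 4 by auto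
          then have "{a, b} \<subseteq> {1..<n}" by (simp add: reduced_def)
          then show False
            using braid_321[OF reduced_sandwich[OF aba(1)]] avoid unfolding contains_321_iff aba(2) by blast
        qed
        ultimately show ?thesis using 4 by simp
      qed auto
    qed
    then show "planar (bruhat_graph n \<sigma>)"
      using planar_below_boolean3 len3 sub w(2) by simp
  qed
qed

end
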